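(* There exists an algorithm which, given a graph $G$ and an integer $k$, decides whether $G$ has a spanning tree with at least $k$ leaves, in time $O(m)+O^*(6.75^k)$, where $m$ denotes the size of the input graph.
   Context: This is the decision problem Max-Leaves Spanning Tree: given a (simple, connected) graph $G$ and an integer $k$, does $G$ have a spanning tree $T$ with at least $k$ leaves (vertices of degree 1 in $T$)? The notation $O^*(f(k))$ means $O(f(k)\cdot p)$ for some polynomial factor $p$ in the input size and $k$, i.e. polynomial factors are suppressed. *)

theory Defs
  imports Complex_Main "HOL-Computational_Algebra.Polynomial"
begin

section \<open>Finite simple graphs and spanning trees\<close>

text \<open>A graph is given by its vertex set \<open>V\<close> and its set \<open>E\<close> of two-element edges.\<close>

definition simple_graph :: "'a set \<Rightarrow> 'a set set \<Rightarrow> bool" where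
  "simple_graph V E \<longleftrightarrow> finite V \<and> V \<noteq> {} \<and> (\<forall>e\<in>E. e \<subseteq> V \<and> card e = 2)"

definition connected_graph :: "'a set \<Rightarrow> 'a set set \<Rightarrow> bool" where
  "connected_graph V E \<longleftrightarrow> (\<forall>u\<in>V. \<forall>v\<in>V. (u, v) \<in> {(x, y). {x, y} \<in> E}\<^sup>*)"

definition cycle :: "'a set set \<Rightarrow> 'a list \<Rightarrow> bool" where
  "cycle E vs \<longleftrightarrow> distinct vs \<and> 3 \<le> length vs \<and>
     (\<forall>i<length vs. {vs ! i, vs ! (Suc i mod length vs)} \<in> E)"

definition tree :: "'a set \<Rightarrow> 'a set set \<Rightarrow> bool" where
  "tree V T \<longleftrightarrow> simple_graph V T \<and> connected_graph V T \<and> (\<nexists>vs. cycle T vs)"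

definition spanning_tree :: "'a set \<Rightarrow> 'a set set \<Rightarrow> 'a set set \<Rightarrow> bool" where
  "spanning_tree V E T \<longleftrightarrow> T \<subseteq> E \<and> tree V T"

definition degree :: "'a set set \<Rightarrow> 'a \<Rightarrow> nat" where
  "degree E v = card {e \<in> E. v \<in> e}"

definition leaves :: "'a set \<Rightarrow> 'a set set \<Rightarrow> 'a set" where
  "leaves V T = {v \<in> V. degree T v = 1}"

definition max_leaves_spanning_tree :: "'a set \<Rightarrow> 'a set set \<Rightarrow> int \<Rightarrow> bool" where
  "max_leaves_spanning_tree V E k \<longleftrightarrow>
     (\<exists>T. spanning_tree V E T \<and> k \<le> int (card (leaves V T)))"

section \<open>Random access machines with uniform cost\<close>

text \<open>
  The additive random access machine of Cook and Reckhow: registers hold integers and are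
  initially 0, the input is a read-once sequence of integers, and each executed instruction costs
  one time unit.  There is deliberately no multiplication, which under uniform cost would not be
  polynomially related to Turing machine time.  For totality, registers are indexed by all
  integers, not only the non-negative ones.

  \<open>Load d a\<close> and \<open>Store a s\<close> are the indirect instructions: the former copies into register
  \<open>d\<close> the register whose index is held in register \<open>a\<close>, the latter copies register \<open>s\<close> to the
  register whose index is held in register \<open>a\<close>.
\<close>

datatype instr =
    Const int int
  | Add int int int
  | Sub int int int
  | Load int int
  | Store int int
  | JumpPos int nat
  | Read int
  | Halt bool

text \<open>A configuration: program counter, register contents, and the unread part of the input.\<close>

type_synonym config = "nat \<times> (int \<Rightarrow> int) \<times> int list"

text \<open>
  The effect of an instruction other than \<open>Halt\<close>; \<open>None\<close> means that there is no successor
  configuration, in particular when reading past the end of the input.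
\<close>

fun exec :: "instr \<Rightarrow> config \<Rightarrow> config option" where
  "exec (Const d c) (pc, R, xs) = Some (Suc pc, R(d := c), xs)"
| "exec (Add d a b) (pc, R, xs) = Some (Suc pc, R(d := R a + R b), xs)"
| "exec (Sub d a b) (pc, R, xs) = Some (Suc pc, R(d := R a - R b), xs)"
| "exec (Load d a) (pc, R, xs) = Some (Suc pc, R(d := R (R a)), xs)"
| "exec (Store a s) (pc, R, xs) = Some (Suc pc, R(R a := R s), xs)"
| "exec (JumpPos a l) (pc, R, xs) = Some (if R a > 0 then l else Suc pc, R, xs)"
| "exec (Read d) (pc, R, x # xs) = Some (Suc pc, R(d := x), xs)"
| "exec (Read d) (pc, R, []) = None"
| "exec (Halt b) c = None"

text \<open>\<open>halts_with P c b t\<close>: started in \<open>c\<close>, program \<open>P\<close> halts with answer \<open>b\<close> after exactly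
  \<open>t\<close> instructions, the final \<open>Halt\<close> included.\<close>

inductive halts_with :: "instr list \<Rightarrow> config \<Rightarrow> bool \<Rightarrow> nat \<Rightarrow> bool" for P where
  halt: "fst c < length P \<Longrightarrow> P ! fst c = Halt b \<Longrightarrow> halts_with P c b 1"
| step: "fst c < length P \<Longrightarrow> exec (P ! fst c) c = Some c' \<Longrightarrow> halts_with P c' b t
    \<Longrightarrow> halts_with P c b (Suc t)"

lemma halts_with_unique:
  "halts_with P c b t \<Longrightarrow> halts_with P c b' t' \<Longrightarrow> b = b' \<and> t = t'"
proof (induction arbitrary: b' t' rule: halts_with.induct)
  case (halt c b)
  from halt.prems show ?case
    by cases (simp_all add: halt.hyps)
next
  case (step c c' b t)
  note hyps = step.hyps and IH = step.IH
  from step.prems show ?case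
  proof cases
    case halt
    with hyps(2) show ?thesis by simp
  next
    case (step c2 t2)
    from step(3) hyps(2) have "c2 = c'" by simp
    with step(4) IH have "b = b' \<and> t = t2" by blast
    with step(1) show ?thesis by simp
  qed
qed

definition answers_in_time :: "instr list \<Rightarrow> int list \<Rightarrow> bool \<Rightarrow> nat \<Rightarrow> bool" where
  "answers_in_time P xs b t \<longleftrightarrow> halts_with P (0, (\<lambda>_. 0), xs) b t"

section \<open>Input format\<close>

text \<open>
  The input lists the number of vertices, the number of edges, the integer \<open>k\<close>, and then the two
  endpoints of every edge.  The vertices are numbered consecutively from 0; each edge occurs
  exactly once, but the order of the edges and of the endpoints of each edge is arbitrary.
\<close>

definition encodes_instance :: "int list \<Rightarrow> nat set \<Rightarrow> nat set set \<Rightarrow> int \<Rightarrow> bool" where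
  "encodes_instance xs V E k \<longleftrightarrow>
     V = {..<card V} \<and>
     (\<exists>es. E = (\<lambda>(u, v). {u, v}) ` set es \<and> length es = card E \<and>
       xs = int (card V) # int (card E) # k # concat (map (\<lambda>(u, v). [int u, int v]) es))"

end

theory Submission
  imports Defs
begin

text \<open>
  With at least three vertices, a spanning tree with \<open>k\<close> leaves exists iff some connected set \<open>I\<close>
  of vertices has at least \<open>k\<close> neighbours outside \<open>I\<close>: take for \<open>I\<close> the inner vertices of
  the tree, or conversely extend a spanning tree of \<open>I\<close> with its neighbours as leaves.
  Such a set is grown from a root by the branching of Kneis, Langer and Rossmanith: a leaf of the
  current tree either stays a leaf for ever or becomes inner, and then all its new neighbours become
  leaves; if there is exactly one new neighbour, that one becomes inner as well, without branching.
  Each decision increases the number of final leaves or the number of leaves, and both stay below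
  \<open>k\<close> until the set is found, so at most \<open>2k\<close> decisions matter.  Instead of recursing, the machine
  tries, for every root, all \<open>4^k\<close> sequences of \<open>2k\<close> decisions, each in polynomial time, and \<open>4 \<le> 6.75\<close>.
  The kernelisation behind the term \<open>O(m)\<close> is not needed, as the polynomial may depend on \<open>m\<close>.
\<close>

section \<open>Structured programs\<close>

text \<open>The rule for a single new neighbour rests on an exchange argument. Let \<open>J\<close>
  be a smallest connected set that contains the root and has at least \<open>k\<close> boundary
  vertices, and let the current inner vertices lie in \<open>J\<close>. If a leaf \<open>u\<close>
  in \<open>J\<close> had no new neighbour, or just one and that outside \<open>J\<close>, then
  \<open>J - {u}\<close> would still be connected with no smaller boundary: \<open>u\<close> enters
  the boundary and at most one vertex leaves it. So making \<open>u\<close> inner either gains a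
  leaf at once, or its only new neighbour is in \<open>J\<close> and may be forced. The root hangs
  on no earlier vertex, so it is exempt from the rule. A run is a fixed number of identical moves
  driven by one integer, which asks of the machine only loops with a counter, additions and
  subtractions. Since the cost has to be proved together with the answer, the program is written in
  a small structured language whose total-correctness calculus carries an instruction
  counter.\<close>

primrec steps :: "instr list \<Rightarrow> nat \<Rightarrow> config \<Rightarrow> config option" where
  "steps P 0 c = Some c"
| "steps P (Suc t) c =
     (if fst c < length P then Option.bind (exec (P ! fst c) c) (steps P t) else None)"

lemma steps_add:
  "steps P s c = Some c' \<Longrightarrow> steps P t c' = Some c'' \<Longrightarrow> steps P (s + t) c = Some c''"
  by (induction s arbitrary: c) (auto split: if_splits bind_splits)

lemma halts_with_steps:
  "steps P s c = Some c' \<Longrightarrow> halts_with P c' b t \<Longrightarrow> halts_with P c b (s + t)"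
  by (induction s arbitrary: c) (auto split: if_splits bind_splits intro: halts_with.step)

section \<open>Structured commands, their compilation and their weakest preconditions\<close>

datatype com =
    Ins instr
  | Seq com com (infixr ";;" 60)
  | Unless int com
  | DoWhile com int

primrec code_length :: "com \<Rightarrow> nat" where
  "code_length (Ins i) = 1"
| "code_length (c ;; d) = code_length c + code_length d"
| "code_length (Unless x c) = Suc (code_length c)"
| "code_length (DoWhile c x) = Suc (code_length c)"

primrec compile :: "com \<Rightarrow> nat \<Rightarrow> instr list" where
  "compile (Ins i) p = [i]"
| "compile (c ;; d) p = compile c p @ compile d (p + code_length c)"
| "compile (Unless x c) p = JumpPos x (p + Suc (code_length c)) # compile c (Suc p)"
| "compile (DoWhile c x) p = compile c p @ [JumpPos x p]"

lemma length_compile [simp]: "length (compile c p) = code_length c"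
  by (induction c arbitrary: p) auto

text \<open>The third component of a state counts the instructions executed so far.\<close>

type_synonym state = "(int \<Rightarrow> int) \<times> int list \<times> nat"

text \<open>One continuation for each outcome of a \<open>JumpPos\<close>: in \<open>Unless\<close>
  the jump skips the body, in \<open>DoWhile\<close> it returns to the loop head.\<close>

definition branch :: "int \<Rightarrow> (state \<Rightarrow> bool) \<Rightarrow> (state \<Rightarrow> bool) \<Rightarrow> state \<Rightarrow> bool" where
  "branch x W Q = (\<lambda>(R, xs, t). if R x > 0 then W (R, xs, Suc t) else Q (R, xs, Suc t))"

lemma branch_simp [simp]:
  "branch x W Q (R, xs, t) = (if R x > 0 then W (R, xs, Suc t) else Q (R, xs, Suc t))"
  by (simp add: branch_def)

lemma branch_mono:
  "branch x W Q s \<Longrightarrow> (\<And>s. W s \<Longrightarrow> W' s) \<Longrightarrow> (\<And>s. Q s \<Longrightarrow> Q' s) \<Longrightarrow> branch x W' Q' s"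
  by (cases s) (auto split: if_splits)

text \<open>Total correctness: the iterates in the last equation start from falsity, so the loop must
  terminate.\<close>

primrec wp :: "com \<Rightarrow> (state \<Rightarrow> bool) \<Rightarrow> state \<Rightarrow> bool" where
  "wp (Ins i) Q = (\<lambda>(R, xs, t). \<exists>R' xs'.
     (\<forall>pc. exec i (pc, R, xs) = Some (Suc pc, R', xs')) \<and> Q (R', xs', Suc t))"
| "wp (c ;; d) Q = wp c (wp d Q)"
| "wp (Unless x c) Q = branch x Q (wp c Q)"
| "wp (DoWhile c x) Q = (\<lambda>s. \<exists>i. ((\<lambda>W. wp c (branch x W Q)) ^^ i) (\<lambda>_. False) s)"

lemma wp_mono: "wp c Q s \<Longrightarrow> (\<And>s. Q s \<Longrightarrow> Q' s) \<Longrightarrow> wp c Q' s"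
proof (induction c arbitrary: Q Q' s)
  case (Seq c d)
  from Seq.prems(1) have "wp c (wp d Q) s" by simp
  then have "wp c (wp d Q') s"
    by (rule Seq.IH(1)) (rule Seq.IH(2), assumption, rule Seq.prems(2))
  then show ?case by simp
next
  case (Unless x c)
  obtain R xs t where [simp]: "s = (R, xs, t)" by (cases s)
  show ?case using Unless.prems Unless.IH[of Q "(R, xs, Suc t)" Q'] by (auto split: if_splits)
next
  case (DoWhile c x)
  let ?F = "\<lambda>Q W. wp c (branch x W Q)"
  have "(?F Q ^^ i) (\<lambda>_. False) s \<Longrightarrow> (?F Q' ^^ i) (\<lambda>_. False) s" for i s
  proof (induction i arbitrary: s)
    case (Suc i)
    from Suc.prems have "?F Q ((?F Q ^^ i) (\<lambda>_. False)) s" by simp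
    then have "?F Q' ((?F Q' ^^ i) (\<lambda>_. False)) s"
      by (rule DoWhile.IH) (erule branch_mono, erule Suc.IH, erule DoWhile.prems(2))
    then show ?case by simp
  qed simp
  then show ?case using DoWhile.prems(1) unfolding wp.simps(4) by blast
qed auto

definition code_at :: "instr list \<Rightarrow> nat \<Rightarrow> instr list \<Rightarrow> bool" where
  "code_at P pc cs \<longleftrightarrow> (\<exists>ps qs. P = ps @ cs @ qs \<and> length ps = pc)"

lemma code_at_Cons:
  "code_at P pc (i # cs) \<Longrightarrow> pc < length P \<and> P ! pc = i \<and> code_at P (Suc pc) cs"
  unfolding code_at_def
  by (auto simp: nth_append) (metis append.assoc append_Cons append_Nil length_append_singleton)

lemma code_at_append:
  "code_at P pc (cs @ ds) \<Longrightarrow> code_at P pc cs \<and> code_at P (pc + length cs) ds"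
  unfolding code_at_def by (metis append.assoc length_append)

text \<open>\<open>pc\<close> is arbitrary in the induction because jump targets are absolute. The
  clock advances by exactly the number of machine steps, so a time bound proved with
  \<open>wp\<close> is a bound for the machine.\<close>

lemma wp_compile:
  assumes "wp c Q (R, xs, t)" "code_at P pc (compile c pc)"
  shows "\<exists>s R' xs'. steps P s (pc, R, xs) = Some (pc + code_length c, R', xs') \<and> Q (R', xs', t + s)"
  using assms
proof (induction c arbitrary: Q R xs t pc)
  case (Ins i)
  then obtain R' xs' where
    "exec i (pc, R, xs) = Some (Suc pc, R', xs')" "Q (R', xs', Suc t)" by auto
  moreover have "pc < length P" "P ! pc = i" using code_at_Cons[of P pc i "[]"] Ins by auto
  ultimately show ?case by (intro exI[of _ 1] exI[of _ R'] exI[of _ xs']) simp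
next
  case (Seq c d)
  from Seq.prems(2) have at: "code_at P pc (compile c pc)"
    "code_at P (pc + code_length c) (compile d (pc + code_length c))"
    using code_at_append by fastforce+
  from Seq.prems(1) have "wp c (wp d Q) (R, xs, t)" by simp
  from Seq.IH(1)[OF this at(1)] obtain s R1 xs1 where
    1: "steps P s (pc, R, xs) = Some (pc + code_length c, R1, xs1)" "wp d Q (R1, xs1, t + s)"
    by blast
  from Seq.IH(2)[OF this(2) at(2)] obtain s' R2 xs2 where
    2: "steps P s' (pc + code_length c, R1, xs1) =
        Some (pc + code_length c + code_length d, R2, xs2)" "Q (R2, xs2, t + s + s')"
    by blast
  show ?case using steps_add[OF 1(1) 2(1)] 2(2)
    by (intro exI[of _ "s + s'"] exI[of _ R2] exI[of _ xs2]) (simp add: add.assoc)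
next
  case (Unless x c)
  from code_at_Cons[OF Unless.prems(2)[unfolded compile.simps]]
  have at: "pc < length P" "P ! pc = JumpPos x (pc + Suc (code_length c))"
    "code_at P (Suc pc) (compile c (Suc pc))" by auto
  show ?case
  proof (cases "R x > 0")
    case True
    then show ?thesis using Unless.prems(1) at
      by (intro exI[of _ 1] exI[of _ R] exI[of _ xs]) simp
  next
    case False
    with Unless.prems(1) have "wp c Q (R, xs, Suc t)" by simp
    from Unless.IH[OF this at(3)] obtain s R' xs' where
      "steps P s (Suc pc, R, xs) = Some (Suc pc + code_length c, R', xs')" "Q (R', xs', Suc t + s)"
      by blast
    then show ?thesis using at False
      by (intro exI[of _ "Suc s"] exI[of _ R'] exI[of _ xs']) simp
  qed
next
  case (DoWhile c x)
  from DoWhile.prems(2) have at: "code_at P pc (compile c pc)"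
    "pc + code_length c < length P" "P ! (pc + code_length c) = JumpPos x pc"
    using code_at_append code_at_Cons[of P "pc + code_length c" "JumpPos x pc" "[]"] by fastforce+
  let ?F = "\<lambda>W. wp c (branch x W Q)"
  \<comment> \<open>Induction on the number of unrollings: each is one pass through the body and the
    closing jump, either back to \<open>pc\<close> or past the loop.\<close>
  have "(?F ^^ i) (\<lambda>_. False) (R, xs, t) \<Longrightarrow>
    \<exists>s R' xs'. steps P s (pc, R, xs) = Some (pc + Suc (code_length c), R', xs') \<and> Q (R', xs', t + s)"
    for i R xs t
  proof (induction i arbitrary: R xs t)
    case (Suc i)
    from Suc.prems have "?F ((?F ^^ i) (\<lambda>_. False)) (R, xs, t)" by simp
    from DoWhile.IH[OF this at(1)] obtain s R1 xs1 where
      1: "steps P s (pc, R, xs) = Some (pc + code_length c, R1, xs1)" and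
      c: "if R1 x > 0 then (?F ^^ i) (\<lambda>_. False) (R1, xs1, Suc (t + s)) else Q (R1, xs1, Suc (t + s))"
      by fastforce
    have 2: "steps P 1 (pc + code_length c, R1, xs1) =
        Some (if R1 x > 0 then pc else pc + Suc (code_length c), R1, xs1)"
      using at by simp
    show ?case
    proof (cases "R1 x > 0")
      case True
      with c have "(?F ^^ i) (\<lambda>_. False) (R1, xs1, Suc (t + s))" by simp
      from Suc.IH[OF this] obtain s' R2 xs2 where
        3: "steps P s' (pc, R1, xs1) = Some (pc + Suc (code_length c), R2, xs2)"
          "Q (R2, xs2, Suc (t + s) + s')" by blast
      show ?thesis using steps_add[OF steps_add[OF 1 2]] 3 True
        by (intro exI[of _ "s + 1 + s'"] exI[of _ R2] exI[of _ xs2]) (simp add: add.assoc)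
    next
      case False
      then show ?thesis using steps_add[OF 1 2] c
        by (intro exI[of _ "s + 1"] exI[of _ R1] exI[of _ xs1]) simp
    qed
  qed simp
  then show ?case using DoWhile.prems(1) by auto
qed

lemma wp_Ins [simp]:
  "wp (Ins (Const d a)) Q (R, xs, t) = Q (R(d := a), xs, Suc t)"
  "wp (Ins (Add d x y)) Q (R, xs, t) = Q (R(d := R x + R y), xs, Suc t)"
  "wp (Ins (Sub d x y)) Q (R, xs, t) = Q (R(d := R x - R y), xs, Suc t)"
  "wp (Ins (Load d x)) Q (R, xs, t) = Q (R(d := R (R x)), xs, Suc t)"
  "wp (Ins (Store x y)) Q (R, xs, t) = Q (R(R x := R y), xs, Suc t)"
  "wp (Ins (Read d)) Q (R, a # xs, t) = Q (R(d := a), xs, Suc t)"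
  by auto

declare wp.simps(1) [simp del]

text \<open>Registers 0 and 15 are reserved for the constant 1 and for intermediate results.\<close>

definition When :: "int \<Rightarrow> com \<Rightarrow> com" where
  "When x c = Ins (Sub 15 0 x) ;; Unless 15 c"

text \<open>The guard caters for zero rounds, since \<open>DoWhile\<close> runs its body before the
  first test.\<close>

definition For :: "int \<Rightarrow> com \<Rightarrow> com" where
  "For x c = When x (DoWhile (Ins (Sub x x 0) ;; c) x)"

text \<open>On integers \<open>1 - R x > 0\<close> is the negation of \<open>R x > 0\<close>, which
  turns a jump that skips into a test that admits. Register 15 is overwritten in both cases.\<close>

lemma wp_When:
  assumes "R 0 = 1"
  shows "wp (When x c) Q (R, xs, t) =
    (if R x > 0 then wp c Q (R(15 := 1 - R x), xs, t + 2) else Q (R(15 := 1 - R x), xs, t + 2))"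
  using assms by (simp add: When_def)

text \<open>The index of the invariant is the number of rounds still to come, as is the counter
  register; the body thus sees \<open>N - 1\<close> down to 0. The guard accounts for
  \<open>t + 2\<close>, the decrement for \<open>Suc t\<close> and the closing jump for
  \<open>Suc t'\<close>.\<close>

lemma wp_For:
  assumes one: "R 0 = 1" and x: "x \<noteq> 15" and N: "nat (R x) = N"
    and init: "Inv N (R(15 := 1 - R x)) xs (t + 2)"
    and body: "\<And>i R xs t. i < N \<Longrightarrow> R x = int (Suc i) \<Longrightarrow> Inv (Suc i) R xs t \<Longrightarrow> R 0 = 1 \<and>
      wp c (\<lambda>(R', xs', t'). R' x = int i \<and> Inv i R' xs' (Suc t')) (R(x := int i), xs, Suc t)"
    and fin: "\<And>R xs t. Inv 0 R xs t \<Longrightarrow> Q (R, xs, t)"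
  shows "wp (For x c) Q (R, xs, t)"
proof (cases "R x > 0")
  case False
  then show ?thesis using one N init fin by (simp add: For_def wp_When)
next
  case True
  let ?c = "Ins (Sub x x 0) ;; c"
  let ?F = "\<lambda>W. wp ?c (branch x W Q)"
  \<comment> \<open>With \<open>Suc i\<close> on the counter, that many unrollings over falsity
    suffice.\<close>
  have "(?F ^^ Suc i) (\<lambda>_. False) (R, xs, t)"
    if "i < N" "R x = int (Suc i)" "Inv (Suc i) R xs t" for i R xs t
    using that
  proof (induction i arbitrary: R xs t)
    case (0 R xs t)
    note b = body[OF 0]
    have "wp c (branch x (\<lambda>_. False) Q) (R(x := int 0), xs, Suc t)"
      by (rule wp_mono[OF conjunct2[OF b]]) (auto intro: fin)
    with b 0 show ?case by simp
  next
    case (Suc i R xs t)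
    note b = body[OF Suc.prems]
    have "wp c (branch x ((?F ^^ Suc i) (\<lambda>_. False)) Q) (R(x := int (Suc i)), xs, Suc t)"
      by (rule wp_mono[OF conjunct2[OF b]]) (use Suc.IH Suc.prems(1) in \<open>auto simp del: funpow.simps\<close>)
    then have "?F ((?F ^^ Suc i) (\<lambda>_. False)) (R, xs, t)"
      using b Suc.prems(2) by (simp del: funpow.simps)
    then show ?case by (subst funpow.simps) (simp only: o_def)
  qed
  from this[of "N - 1" "R(15 := 1 - R x)" xs "t + 2"] True N x init
  have "(?F ^^ Suc (N - 1)) (\<lambda>_. False) (R(15 := 1 - R x), xs, t + 2)" by auto
  then have "wp (DoWhile ?c x) Q (R(15 := 1 - R x), xs, t + 2)"
    unfolding wp.simps(4) by blast
  then show ?thesis using True one unfolding For_def by (simp add: wp_When del: wp.simps)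
qed

section \<open>Connected sets and leaves\<close>

definition inside :: "'a set set \<Rightarrow> 'a set \<Rightarrow> ('a \<times> 'a) set" where
  "inside E I = {(x, y). {x, y} \<in> E \<and> x \<in> I \<and> y \<in> I}"

definition boundary :: "'a set \<Rightarrow> 'a set set \<Rightarrow> 'a set \<Rightarrow> 'a set" where
  "boundary V E I = {v \<in> V - I. \<exists>u\<in>I. {u, v} \<in> E}"

text \<open>Says that \<open>I\<close> is nonempty and induces a connected subgraph. Naming one
  vertex leaves a single path per vertex to maintain and matches the search, which tries every
  root.\<close>

definition rooted :: "'a set set \<Rightarrow> 'a \<Rightarrow> 'a set \<Rightarrow> bool" where
  "rooted E r I \<longleftrightarrow> r \<in> I \<and> (\<forall>v\<in>I. (r, v) \<in> (inside E I)\<^sup>*)"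

lemma sym_inside: "sym (inside E I)"
  by (auto simp: inside_def sym_def insert_commute)

lemma inside_mono: "I \<subseteq> J \<Longrightarrow> inside E I \<subseteq> inside E J"
  by (auto simp: inside_def)

lemma rooted_insert:
  assumes "rooted E r I" "u \<in> I" "{u, v} \<in> E"
  shows "rooted E r (insert v I)"
proof -
  have "(r, x) \<in> (inside E (insert v I))\<^sup>*" if "x \<in> I" for x
    using assms(1) that rtrancl_mono[OF inside_mono[of I "insert v I" E]]
    by (auto simp: rooted_def)
  moreover have "(u, v) \<in> inside E (insert v I)" using assms by (auto simp: inside_def)
  ultimately show ?thesis using assms by (auto simp: rooted_def intro: rtrancl_into_rtrancl)
qed

lemma connected_graph_inside:
  assumes "simple_graph V E"
  shows "connected_graph V E \<longleftrightarrow> (\<forall>v\<in>V. rooted E v V)"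
proof -
  have "{(x, y). {x, y} \<in> E} = inside E V" using assms by (auto simp: simple_graph_def inside_def)
  then show ?thesis by (auto simp: connected_graph_def rooted_def)
qed

lemma rooted_imp_connected_graph:
  assumes "rooted E r I"
  shows "connected_graph I {e \<in> E. e \<subseteq> I}"
proof -
  have "{(x, y). {x, y} \<in> {e \<in> E. e \<subseteq> I}} = inside E I" by (auto simp: inside_def)
  moreover have "(u, v) \<in> (inside E I)\<^sup>*" if "u \<in> I" "v \<in> I" for u v
    using assms that sym_rtrancl[OF sym_inside[of E I]]
    unfolding rooted_def by (meson rtrancl_trans symE)
  ultimately show ?thesis unfolding connected_graph_def by simp
qed

section \<open>Growing trees by one leaf at a time\<close>

lemma tree_singleton: "tree {v} {}"
  proof -
  have "\<not> cycle {} vs" for vs :: "'a list" by (cases vs) (auto simp: cycle_def)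
  then show ?thesis by (auto simp: tree_def simple_graph_def connected_graph_def)
qed

lemma finite_edges: "simple_graph V E \<Longrightarrow> finite E"
  by (rule finite_subset[of _ "Pow V"]) (auto simp: simple_graph_def)

text \<open>Predecessor and successor on a cycle differ because its length is at least 3;
  consequently a vertex of degree one lies on no cycle.\<close>

lemma cycle_nbrs:
  assumes "cycle E vs" "y \<in> set vs"
  shows "\<exists>a b. a \<noteq> b \<and> {a, y} \<in> E \<and> {y, b} \<in> E"
proof -
  from assms obtain j where j: "j < length vs" "vs ! j = y" by (auto simp: in_set_conv_nth)
  let ?n = "length vs"
  have n: "3 \<le> ?n" and d: "distinct vs"
    and e: "\<And>i. i < ?n \<Longrightarrow> {vs ! i, vs ! (Suc i mod ?n)} \<in> E"
    using assms by (auto simp: cycle_def)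
  \<comment> \<open>The cyclic predecessor of position \<open>j\<close>.\<close>
  define i where "i = (if j = 0 then ?n - 1 else j - 1)"
  have i: "i < ?n" "Suc i mod ?n = j" using j n by (auto simp: i_def)
  have s: "Suc j mod ?n < ?n" using n by (intro mod_less_divisor) linarith
  have "i \<noteq> Suc j mod ?n"
    using j n by (cases "Suc j = ?n") (auto simp: i_def split: if_splits)
  then have "vs ! i \<noteq> vs ! (Suc j mod ?n)" using d i s by (simp add: nth_eq_iff_index_eq)
  moreover have "{vs ! i, y} \<in> E" using e[OF i(1)] i j by simp
  moreover have "{y, vs ! (Suc j mod ?n)} \<in> E" using e[OF j(1)] j by simp
  ultimately show ?thesis by blast
qed

text \<open>A cycle through \<open>y\<close> would give it two distinct neighbours, but
  \<open>{x, y}\<close> is its only edge; a cycle that avoids \<open>y\<close> already lies in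
  \<open>T\<close>.\<close>

lemma tree_insert:
  assumes T: "tree S T" and x: "x \<in> S" and y: "y \<notin> S"
  shows "tree (insert y S) (insert {x, y} T)"
proof -
  have sg: "simple_graph S T" and cg: "connected_graph S T" and nc: "\<nexists>vs. cycle T vs"
    using T by (auto simp: tree_def)
  have TS: "e \<subseteq> S" if "e \<in> T" for e using sg that by (auto simp: simple_graph_def)
  have sg': "simple_graph (insert y S) (insert {x, y} T)"
    using sg x y by (auto simp: simple_graph_def card_insert_if)
  have "rooted T x S" using cg connected_graph_inside[OF sg] x by blast
  then have "rooted (insert {x, y} T) x S"
    using x rtrancl_mono[of "inside T S" "inside (insert {x, y} T) S"]
    by (auto simp: rooted_def inside_def subset_iff)
  from rooted_insert[OF this x] have "rooted (insert {x, y} T) x (insert y S)" by simp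
  from rooted_imp_connected_graph[OF this]
  have "connected_graph (insert y S) {e \<in> insert {x, y} T. e \<subseteq> insert y S}" .
  moreover have "{e \<in> insert {x, y} T. e \<subseteq> insert y S} = insert {x, y} T" using TS x by blast
  ultimately have cg': "connected_graph (insert y S) (insert {x, y} T)" by simp
  have "\<not> cycle (insert {x, y} T) vs" for vs
  proof
    assume c: "cycle (insert {x, y} T) vs"
    show False
    proof (cases "y \<in> set vs")
      case True
      from cycle_nbrs[OF c this] obtain a b where
        ab: "a \<noteq> b" "{a, y} \<in> insert {x, y} T" "{y, b} \<in> insert {x, y} T" by blast
      have "{a, y} = {x, y}" "{y, b} = {x, y}" using ab TS y by blast+
      then have "a = x" "b = x" using x y by (auto simp: doubleton_eq_iff)
      with ab(1) show False by simp
    next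
      case False
      have "{vs ! i, vs ! (Suc i mod length vs)} \<in> T" if i: "i < length vs" for i
      proof -
        have "Suc i mod length vs < length vs" using i by (intro mod_less_divisor) linarith
        then have "y \<noteq> vs ! i" "y \<noteq> vs ! (Suc i mod length vs)" using False i by auto
        moreover have "{vs ! i, vs ! (Suc i mod length vs)} \<in> insert {x, y} T"
          using c i by (auto simp: cycle_def)
        ultimately show ?thesis by (auto simp: doubleton_eq_iff)
      qed
      then have "cycle T vs" using c by (auto simp: cycle_def)
      with nc show False by blast
    qed
  qed
  with sg' cg' show ?thesis by (auto simp: tree_def)
qed

lemma degree_insert:
  assumes "simple_graph S T" "x \<in> S" "y \<notin> S"
  shows "degree (insert {x, y} T) v = (if v = x \<or> v = y then Suc (degree T v) else degree T v)"
    and "degree T y = 0"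
proof -
  have TS: "e \<subseteq> S" if "e \<in> T" for e using assms that by (auto simp: simple_graph_def)
  have fin: "finite {e \<in> T. v \<in> e}" for v using finite_edges[OF assms(1)] by simp
  have new: "{x, y} \<notin> T" using TS assms by blast
  have "{e \<in> insert {x, y} T. v \<in> e} =
      (if v = x \<or> v = y then insert {x, y} {e \<in> T. v \<in> e} else {e \<in> T. v \<in> e})" by auto
  then show "degree (insert {x, y} T) v = (if v = x \<or> v = y then Suc (degree T v) else degree T v)"
    using new fin by (simp add: degree_def)
  have "{e \<in> T. y \<in> e} = {}" using TS assms by blast
  then show "degree T y = 0" unfolding degree_def by (simp only: card.empty)
qed

text \<open>\<open>x\<close> may cease to be a leaf, but \<open>y\<close> becomes one, so the count
  does not drop.\<close>

lemma leaves_insert: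
  assumes "simple_graph S T" "x \<in> S" "y \<notin> S"
  shows "insert y (leaves S T - {x}) \<subseteq> leaves (insert y S) (insert {x, y} T)"
    and "card (leaves S T) \<le> card (leaves (insert y S) (insert {x, y} T))"
proof -
  have "finite S" using assms by (simp add: simple_graph_def)
  then have fin: "finite (leaves S T)" "finite (leaves (insert y S) (insert {x, y} T))"
    by (auto simp: leaves_def)
  show *: "insert y (leaves S T - {x}) \<subseteq> leaves (insert y S) (insert {x, y} T)"
    using assms(3) degree_insert[OF assms] by (auto simp: leaves_def)
  have "card (leaves S T) \<le> Suc (card (leaves S T - {x}))"
    using fin card_Suc_Diff1[of "leaves S T" x] by (cases "x \<in> leaves S T") auto
  also have "\<dots> = card (insert y (leaves S T - {x}))"
    using fin assms(3) by (simp add: leaves_def)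
  also have "\<dots> \<le> card (leaves (insert y S) (insert {x, y} T))"
    using * fin by (intro card_mono)
  finally show "card (leaves S T) \<le> card (leaves (insert y S) (insert {x, y} T))" .
qed

text \<open>A path that starts in \<open>S\<close> and ends outside must leave \<open>S\<close> at
  some step. This supplies the edges for growing trees, and later an undecided leaf in the target
  set.\<close>

lemma crossing_edge:
  assumes "(r, v) \<in> (inside E I)\<^sup>*" "r \<in> S" "v \<notin> S"
  shows "\<exists>x y. {x, y} \<in> E \<and> x \<in> S \<and> y \<in> I - S"
  using assms by (induction rule: rtrancl_induct) (auto simp: inside_def)

text \<open>As long as \<open>S\<close> is not all of \<open>V\<close>, a crossing edge attaches one
  more vertex, and no such step lowers the number of leaves.\<close>

lemma tree_extend:
  assumes "finite V" "rooted E r V" "tree S T" "T \<subseteq> E" "S \<subseteq> V" "r \<in> S"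
  shows "\<exists>T'. tree V T' \<and> T' \<subseteq> E \<and> card (leaves S T) \<le> card (leaves V T')"
  using assms(3-)
proof (induction "card (V - S)" arbitrary: S T)
  case 0
  then have "S = V" using assms(1) by auto
  then show ?case using 0 by blast
next
  case (Suc n)
  then have "V - S \<noteq> {}" by (intro notI) simp
  then obtain v where v: "v \<in> V" "v \<notin> S" by blast
  have "(r, v) \<in> (inside E V)\<^sup>*" using assms(2) v(1) unfolding rooted_def by blast
  from crossing_edge[OF this Suc.prems(4) v(2)] obtain x y where
    xy: "{x, y} \<in> E" "x \<in> S" "y \<in> V" "y \<notin> S" by blast
  have "card (V - insert y S) = n" using Suc.hyps(2) xy assms(1) by (simp add: card_Diff_insert)
  moreover have "tree (insert y S) (insert {x, y} T)"
    using Suc.prems(1) xy(2,4) by (rule tree_insert)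
  moreover have "insert {x, y} T \<subseteq> E" "insert y S \<subseteq> V" "r \<in> insert y S"
    using xy Suc.prems by blast+
  ultimately obtain T' where T': "tree V T'" "T' \<subseteq> E"
    "card (leaves (insert y S) (insert {x, y} T)) \<le> card (leaves V T')"
    using Suc.hyps(1)[of "insert y S" "insert {x, y} T"] by blast
  have "simple_graph S T" using Suc.prems(1) by (simp add: tree_def)
  from le_trans[OF leaves_insert(2)[OF this xy(2,4)] T'(3)] T'(1,2) show ?case by blast
qed

text \<open>Each vertex of \<open>A\<close> is attached directly to a vertex of \<open>I\<close>.
  The latter is not in \<open>A\<close>, so the vertices of \<open>A\<close> attached earlier stay
  leaves.\<close>

lemma boundary_leaves:
  assumes "tree I T" "T \<subseteq> E" "finite A" "A \<subseteq> boundary V E I"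
  shows "\<exists>T'. tree (I \<union> A) T' \<and> T' \<subseteq> E \<and> A \<subseteq> leaves (I \<union> A) T'"
  using assms(3,4)
proof (induction A rule: finite_induct)
  case empty
  then show ?case using assms by auto
next
  case (insert y A)
  then obtain T' where T': "tree (I \<union> A) T'" "T' \<subseteq> E" "A \<subseteq> leaves (I \<union> A) T'" by auto
  from insert.prems obtain x where x: "x \<in> I" "{x, y} \<in> E" "y \<notin> I" by (auto simp: boundary_def)
  have "x \<notin> A" using insert.prems x by (auto simp: boundary_def)
  have sg: "simple_graph (I \<union> A) T'" using T' by (simp add: tree_def)
  have "insert y A \<subseteq> leaves (insert y (I \<union> A)) (insert {x, y} T')"
    using leaves_insert(1)[OF sg, of x y] x insert.hyps T'(3) \<open>x \<notin> A\<close> by blast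
  moreover have "tree (insert y (I \<union> A)) (insert {x, y} T')"
    using tree_insert[OF T'(1)] x insert.hyps by auto
  ultimately show ?case using T'(2) x by (intro exI[of _ "insert {x, y} T'"]) auto
qed

text \<open>The tree grows from \<open>{r}\<close> to \<open>I\<close>, then by the boundary as
  leaves, then to \<open>V\<close>. In the last stage a boundary vertex may become inner, but the
  leaf count cannot drop.\<close>

lemma many_leaves_if_boundary:
  assumes G: "simple_graph V E" "connected_graph V E" and I: "I \<subseteq> V" "rooted E r I"
  shows "\<exists>T. spanning_tree V E T \<and> card (boundary V E I) \<le> card (leaves V T)"
proof -
  have fin: "finite V" using G by (simp add: simple_graph_def)
  have r: "r \<in> I" using I by (simp add: rooted_def)
  have "finite I" using I fin finite_subset by blast
  from tree_extend[OF this I(2) tree_singleton[of r]] r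
  obtain T1 where T1: "tree I T1" "T1 \<subseteq> E" by auto
  have bV: "boundary V E I \<subseteq> V" by (auto simp: boundary_def)
  then have finb: "finite (boundary V E I)" using fin finite_subset by blast
  from boundary_leaves[OF T1 finb order_refl] obtain T2 where
    T2: "tree (I \<union> boundary V E I) T2" "T2 \<subseteq> E"
      "boundary V E I \<subseteq> leaves (I \<union> boundary V E I) T2" by blast
  have rV: "rooted E r V" using connected_graph_inside[OF G(1)] G(2) I r by blast
  from tree_extend[OF fin rV T2(1,2)] I bV r obtain T where
    T: "tree V T" "T \<subseteq> E" "card (leaves (I \<union> boundary V E I) T2) \<le> card (leaves V T)" by auto
  have "finite (leaves (I \<union> boundary V E I) T2)"
    using \<open>finite I\<close> finb by (auto simp: leaves_def)
  from card_mono[OF this T2(3)] T show ?thesis by (auto simp: spanning_tree_def)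
qed

section \<open>The inner vertices of a given spanning tree\<close>

lemma leaf_edge:
  assumes "x \<in> leaves V T"
  obtains e where "{e \<in> T. x \<in> e} = {e}"
proof -
  have "card {e \<in> T. x \<in> e} = 1" using assms by (simp add: leaves_def degree_def)
  then show thesis by (rule card_1_singletonE) (rule that)
qed

lemma leaf_nbr_unique:
  assumes "x \<in> leaves V T" "{x, y} \<in> T" "{x, z} \<in> T"
  shows "y = z"
proof -
  from assms(1) obtain e where e: "{e \<in> T. x \<in> e} = {e}" by (rule leaf_edge)
  have "{x, y} \<in> {e \<in> T. x \<in> e}" "{x, z} \<in> {e \<in> T. x \<in> e}" using assms(2,3) by simp_all
  then have "{x, y} = {x, z}" unfolding e by simp
  then show ?thesis by (metis doubleton_eq_iff)
qed

lemma leaf_nbr: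
  assumes "simple_graph V T" "x \<in> leaves V T"
  shows "\<exists>y. {x, y} \<in> T \<and> y \<in> V \<and> y \<noteq> x"
proof -
  from assms(2) obtain e where "{e \<in> T. x \<in> e} = {e}" by (rule leaf_edge)
  then have "e \<in> {e \<in> T. x \<in> e}" by simp
  then have e: "e \<in> T" "x \<in> e" by simp_all
  then have "e \<subseteq> V" "card e = 2" using assms(1) unfolding simple_graph_def by blast+
  moreover obtain a b where "e = {a, b}" "a \<noteq> b" using \<open>card e = 2\<close> by (auto simp: card_2_iff)
  ultimately show ?thesis using e by (metis insert_commute insert_iff insert_subset singletonD)
qed

text \<open>If every vertex were a leaf, the ends of any edge would form a whole component, leaving
  room for two vertices only.\<close>

lemma inner_vertex_exists:
  assumes T: "simple_graph V T" "connected_graph V T" and "card V \<ge> 3"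
  shows "V - leaves V T \<noteq> {}"
proof
  assume "V - leaves V T = {}"
  then have L: "\<And>x. x \<in> V \<Longrightarrow> x \<in> leaves V T" by auto
  obtain u where u: "u \<in> V" using T by (auto simp: simple_graph_def)
  then obtain v where v: "{u, v} \<in> T" "v \<in> V" using leaf_nbr[OF T(1) L[OF u]] by blast
  have "x \<in> {u, v}" if "(u, x) \<in> {(x, y). {x, y} \<in> T}\<^sup>*" for x
    using that
  proof (induction rule: rtrancl_induct)
    case (step y z)
    then have yz: "{y, z} \<in> T" by simp
    have vu: "{v, u} \<in> T" using v by (simp add: insert_commute)
    from step.IH consider "y = u" | "y = v" by blast
    then show ?case
    proof cases
      case 1
      then show ?thesis using leaf_nbr_unique[OF L[OF u] v(1)] yz by blast
    next
      case 2
      then show ?thesis using leaf_nbr_unique[OF L[OF v(2)] vu] yz by blast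
    qed
  qed simp
  then have "V \<subseteq> {u, v}" using T(2) u unfolding connected_graph_def by blast
  then have "card V \<le> card {u, v}" by (intro card_mono) auto
  also have "\<dots> \<le> 2" by (simp add: card_insert_if)
  finally show False using assms by simp
qed

lemma boundary_if_many_leaves:
  assumes T: "spanning_tree V E T" and "card V \<ge> 3"
  shows "\<exists>r I. I \<subseteq> V \<and> rooted E r I \<and> card (leaves V T) \<le> card (boundary V E I)"
proof -
  have sg: "simple_graph V T" and cg: "connected_graph V T" and TE: "T \<subseteq> E"
    using T by (auto simp: spanning_tree_def tree_def)
  define I where "I = V - leaves V T"
  obtain r where r: "r \<in> I" using inner_vertex_exists[OF sg cg assms(2)] by (auto simp: I_def)
  have TV: "x \<in> V" "y \<in> V" if "{x, y} \<in> T" for x y using sg that by (auto simp: simple_graph_def)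
  \<comment> \<open>A tree path may visit a leaf, from where it can only return to the leaf's single
    neighbour. The second conjunct records that this neighbour is inner and reached within
    \<open>I\<close>.\<close>
  have *: "(x \<in> I \<longrightarrow> (r, x) \<in> (inside E I)\<^sup>*) \<and>
      (x \<in> leaves V T \<longrightarrow> (\<forall>y. {x, y} \<in> T \<longrightarrow> y \<in> I \<and> (r, y) \<in> (inside E I)\<^sup>*))"
    if "(r, x) \<in> {(x, y). {x, y} \<in> T}\<^sup>*" for x
    using that
  proof (induction rule: rtrancl_induct)
    case base
    then show ?case using r unfolding I_def by blast
  next
    case (step x y)
    then have xy: "{x, y} \<in> T" "{y, x} \<in> T" by (simp_all add: insert_commute)
    show ?case
    proof (cases "x \<in> I")
      case True
      then have rx: "(r, x) \<in> (inside E I)\<^sup>*" using step by blast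
      have "(r, y) \<in> (inside E I)\<^sup>*" if "y \<in> I"
        using rx that True xy TE by (auto simp: inside_def intro: rtrancl_into_rtrancl)
      then show ?thesis using leaf_nbr_unique[OF _ xy(2)] True rx by blast
    next
      case False
      then have "x \<in> leaves V T" using TV xy unfolding I_def by blast
      then have "y \<in> I" "(r, y) \<in> (inside E I)\<^sup>*" using step xy by blast+
      then show ?thesis unfolding I_def by blast
    qed
  qed
  have reach: "(r, x) \<in> {(x, y). {x, y} \<in> T}\<^sup>*" if "x \<in> V" for x
    using cg r that unfolding connected_graph_def I_def by blast
  have "rooted E r I" using * reach r unfolding rooted_def I_def by blast
  moreover have "leaves V T \<subseteq> boundary V E I"
  proof
    fix x assume x: "x \<in> leaves V T"
    then obtain y where y: "{x, y} \<in> T" using leaf_nbr[OF sg] by blast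
    have "x \<in> V" using x by (auto simp: leaves_def)
    then have "y \<in> I" using * reach x y by blast
    moreover have "{y, x} \<in> E" using y TE by (auto simp: insert_commute)
    ultimately show "x \<in> boundary V E I"
      using x \<open>x \<in> V\<close> by (auto simp: boundary_def I_def)
  qed
  moreover have "finite (boundary V E I)" using sg by (simp add: boundary_def simple_graph_def)
  ultimately show ?thesis using card_mono[of "boundary V E I" "leaves V T"]
    by (intro exI[of _ r] exI[of _ I]) (auto simp: I_def)
qed

lemma two_leaves:
  assumes G: "simple_graph V E" "connected_graph V E" and "card V = 2"
  shows "\<exists>T. spanning_tree V E T \<and> card (leaves V T) = 2"
proof -
  from assms(3) obtain a b where V: "V = {a, b}" "a \<noteq> b" by (auto simp: card_2_iff)
  have "rooted E a V" using connected_graph_inside[OF G(1)] G(2) V by auto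
  then have "(a, b) \<in> (inside E V)\<^sup>*" using V by (simp add: rooted_def)
  then obtain x y where "{x, y} \<in> E" "x \<in> {a}" "y \<in> V - {a}"
    using crossing_edge[of a b E V "{a}"] V by auto
  then have e: "{a, b} \<in> E" using V by auto
  have t: "tree V {{a, b}}" using tree_insert[OF tree_singleton[of a], of a b] V
    by (simp add: insert_commute)
  have "{e \<in> {{a, b}}. v \<in> e} = {{a, b}}" if "v \<in> V" for v using that V by auto
  then have "leaves V {{a, b}} = V" by (auto simp: leaves_def degree_def)
  then show ?thesis using t e assms(3) by (intro exI[of _ "{{a, b}}"]) (simp add: spanning_tree_def)
qed

text \<open>With two vertices both are leaves, but a nonempty \<open>I\<close> leaves at most one
  boundary vertex; hence the separate disjunct. With one vertex there is no leaf, and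
  \<open>I = V\<close> has empty boundary.\<close>

theorem max_leaves_iff:
  assumes G: "simple_graph V E" "connected_graph V E"
  shows "max_leaves_spanning_tree V E k \<longleftrightarrow>
    card V = 2 \<and> k \<le> 2 \<or> (\<exists>r I. I \<subseteq> V \<and> rooted E r I \<and> k \<le> int (card (boundary V E I)))"
    (is "?L \<longleftrightarrow> ?A \<or> ?B")
proof
  assume "?A \<or> ?B"
  then show ?L
  proof
    assume ?A
    then show ?L using two_leaves[OF G] unfolding max_leaves_spanning_tree_def by fastforce
  next
    assume ?B
    then show ?L using many_leaves_if_boundary[OF G] unfolding max_leaves_spanning_tree_def
      by (meson of_nat_mono order_trans)
  qed
next
  assume ?L
  then obtain T where T: "spanning_tree V E T" "k \<le> int (card (leaves V T))"
    by (auto simp: max_leaves_spanning_tree_def)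
  have fin: "finite V" "V \<noteq> {}" using G by (auto simp: simple_graph_def)
  have le: "card (leaves V T) \<le> card V" using fin by (intro card_mono) (auto simp: leaves_def)
  consider "card V = 1" | "card V = 2" | "card V \<ge> 3"
    using fin card_gt_0_iff[of V] by linarith
  then show "?A \<or> ?B"
  proof cases
    case 1
    then obtain v where V: "V = {v}" by (auto simp: card_1_singleton_iff)
    have sg: "simple_graph V T" using T by (simp add: spanning_tree_def tree_def)
    have "leaves V T = {}" using leaf_nbr[OF sg] V by (auto simp: leaves_def)
    then show ?thesis using T V
      by (intro disjI2 exI[of _ v] exI[of _ "{v}"]) (auto simp: rooted_def)
  next
    case 2
    then show ?thesis using le T by auto
  next
    case 3
    then show ?thesis using boundary_if_many_leaves[OF T(1)] T(2)
      by (meson of_nat_mono order_trans)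
  qed
qed

text \<open>Every vertex except possibly \<open>r\<close> is an end of some edge. This turns time
  bounds that mention vertices into bounds in the number of edges alone.\<close>

lemma card_le_edges:
  assumes G: "simple_graph V E" "connected_graph V E"
  shows "card V \<le> 2 * card E + 1"
proof -
  obtain r where r: "r \<in> V" using G by (auto simp: simple_graph_def)
  have "V \<subseteq> insert r (\<Union>E)"
  proof
    fix v assume v: "v \<in> V"
    then have "(r, v) \<in> {(x, y). {x, y} \<in> E}\<^sup>*" using G r by (auto simp: connected_graph_def)
    then show "v \<in> insert r (\<Union>E)" by cases auto
  qed
  moreover have finE: "finite E" by (rule finite_edges[OF G(1)])
  moreover have "\<forall>e\<in>E. finite e \<and> card e = 2"
    using G(1) finite_subset by (auto simp: simple_graph_def)
  moreover have "finite (\<Union>E)" using calculation by auto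
  ultimately have "card V \<le> card (insert r (\<Union>E))" by (intro card_mono) auto
  also have "\<dots> \<le> Suc (card (\<Union>E))" by (simp add: card_insert_le_m1 card_insert_if \<open>finite (\<Union>E)\<close>)
  also have "card (\<Union>E) \<le> (\<Sum>e\<in>E. card e)"
    using finE card_UN_le[of E "\<lambda>e. e"] by simp
  also have "\<dots> = 2 * card E" using \<open>\<forall>e\<in>E. finite e \<and> card e = 2\<close> by simp
  finally show ?thesis by simp
qed

section \<open>The branching algorithm\<close>

text \<open>The exchange argument. Neighbours of \<open>u\<close> in \<open>J\<close> lie in
  \<open>I\<close> or its boundary, hence are reached through \<open>I\<close> without
  \<open>u\<close>. Only vertices of \<open>N\<close> can leave the boundary when \<open>u\<close>
  is removed from \<open>J\<close>, and \<open>u\<close>, being adjacent to \<open>I\<close>, enters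
  it.\<close>

lemma rooted_remove:
  assumes I: "I \<subseteq> J" "rooted E r I" and J: "rooted E r J" "J \<subseteq> V"
    and u: "u \<in> boundary V E I" and fin: "finite V"
    and N: "N = {v. {u, v} \<in> E} - I - boundary V E I" "N \<inter> J = {}" "card N \<le> 1"
    and E: "\<And>x y. {x, y} \<in> E \<Longrightarrow> x \<in> V \<and> y \<in> V"
  shows "rooted E r (J - {u})" and "card (boundary V E J) \<le> card (boundary V E (J - {u}))"
proof -
  let ?J = "J - {u}"
  from u obtain x where ux: "u \<notin> I" "x \<in> I" "{x, u} \<in> E" by (auto simp: boundary_def)
  have r: "r \<in> I" using I by (simp add: rooted_def)
  have IJ: "I \<subseteq> ?J" using I(1) ux by blast
  have inI: "(r, y) \<in> (inside E ?J)\<^sup>*" if "y \<in> I" for y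
    using I(2) that rtrancl_mono[OF inside_mono[OF IJ]] unfolding rooted_def by blast
  have near: "(r, y) \<in> (inside E ?J)\<^sup>*" if y: "y \<in> ?J" "{u, y} \<in> E" for y
  proof -
    from y N have "y \<in> I \<or> y \<in> boundary V E I" by blast
    then show ?thesis
    proof
      assume "y \<in> boundary V E I"
      then obtain z where z: "z \<in> I" "{z, y} \<in> E" by (auto simp: boundary_def)
      then have "(z, y) \<in> inside E ?J" using IJ y by (auto simp: inside_def)
      with inI[OF z(1)] show ?thesis by (rule rtrancl_into_rtrancl)
    qed (rule inI)
  qed
  \<comment> \<open>Where the path passes through \<open>u\<close>, its next vertex is reached anew
    by \<open>near\<close>.\<close>
  have "(r, y) \<in> (inside E ?J)\<^sup>*" if "(r, y) \<in> (inside E J)\<^sup>*" "y \<noteq> u" for y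
    using that
  proof (induction rule: rtrancl_induct)
    case (step y z)
    then have yz: "{y, z} \<in> E" "y \<in> J" "z \<in> J" by (auto simp: inside_def)
    show ?case
    proof (cases "y = u")
      case True
      then show ?thesis using near yz step by blast
    next
      case False
      then have "(y, z) \<in> inside E ?J" using yz step by (auto simp: inside_def)
      with step.IH[OF False] show ?thesis by (rule rtrancl_into_rtrancl)
    qed
  qed simp
  then show "rooted E r ?J" using J(1) r ux unfolding rooted_def by blast
  show "card (boundary V E J) \<le> card (boundary V E ?J)"
  proof (cases "u \<in> J")
    case True
    have "v \<in> boundary V E ?J" if v: "v \<in> boundary V E J" "v \<notin> N" for v
    proof -
      from v obtain z where z: "z \<in> J" "{z, v} \<in> E" "v \<in> V" "v \<notin> J" by (auto simp: boundary_def)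
      show ?thesis
      proof (cases "z = u")
        case True
        then have "v \<in> boundary V E I" using z v N(1) I(1) by blast
        then show ?thesis using IJ z by (auto simp: boundary_def)
      next
        case False
        then show ?thesis using z by (auto simp: boundary_def)
      qed
    qed
    moreover have "u \<in> boundary V E ?J" using ux IJ u by (auto simp: boundary_def)
    ultimately have "insert u (boundary V E J - N) \<subseteq> boundary V E ?J" by blast
    then have "card (insert u (boundary V E J - N)) \<le> card (boundary V E ?J)"
      using fin by (intro card_mono) (auto simp: boundary_def)
    moreover have "u \<notin> boundary V E J" using True by (auto simp: boundary_def)
    moreover have "finite (boundary V E J)" using fin by (simp add: boundary_def)
    moreover have "N \<subseteq> V" using E N(1) by blast
    moreover have "card (boundary V E J) - card N \<le> card (boundary V E J - N)"
      using \<open>N \<subseteq> V\<close> fin by (intro diff_card_le_card_Diff) (rule finite_subset)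
    ultimately show ?thesis using N(3) by simp
  qed simp
qed

text \<open>Colours: \<open>-2\<close> for a vertex not yet reached, \<open>-1\<close> for an inner vertex of the tree,
  \<open>0\<close> for a leaf that has to stay a leaf, \<open>1\<close> for a leaf that is still undecided.
  \<open>pick\<close> returns \<open>n\<close>, which is not a vertex, if no leaf is undecided.\<close>

definition pick :: "nat \<Rightarrow> (nat \<Rightarrow> int) \<Rightarrow> nat" where
  "pick n col = (LEAST v. v < n \<longrightarrow> col v = 1)"

definition fresh :: "nat set set \<Rightarrow> (nat \<Rightarrow> int) \<Rightarrow> nat \<Rightarrow> nat set" where
  "fresh E col u = {v. {u, v} \<in> E \<and> col v = -2}"

definition expand :: "nat set set \<Rightarrow> (nat \<Rightarrow> int) \<Rightarrow> nat \<Rightarrow> nat \<Rightarrow> int" where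
  "expand E col u = (\<lambda>v. if v \<in> fresh E col u then 1 else (col(u := -1)) v)"

definition forced :: "nat set set \<Rightarrow> (nat \<Rightarrow> int) \<Rightarrow> nat \<Rightarrow> nat option" where
  "forced E col u =
     (if card (fresh E col u) = 1 then Some (the_elem (fresh E col u)) else None)"

text \<open>The decisions are the binary digits of \<open>q / P\<close>; the machine has no bitwise operations,
  but the leading digit is found by doubling.\<close>

fun move :: "nat \<Rightarrow> nat set set \<Rightarrow> int \<Rightarrow> (nat \<Rightarrow> int) \<times> nat option \<times> int
    \<Rightarrow> (nat \<Rightarrow> int) \<times> nat option \<times> int" where
  "move n E P (col, Some w, q) = (expand E col w, forced E col w, q)"
| "move n E P (col, None, q) =
    (if P \<le> 2 * q then (expand E col (pick n col), forced E col (pick n col), 2 * q - P)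
     else (col(pick n col := 0), None, 2 * q))"

text \<open>A move settles one vertex while an undecided leaf remains, and the initial expansion
  settles the root; hence \<open>n - 1\<close> moves. The forced component starts as
  \<open>None\<close> even if the root has a single neighbour, because \<open>rooted_remove\<close>
  requires \<open>u\<close> to be adjacent to an earlier inner vertex.\<close>

definition run :: "nat \<Rightarrow> nat set set \<Rightarrow> int \<Rightarrow> nat \<Rightarrow> int \<Rightarrow> nat \<Rightarrow> int" where
  "run n E P r q = fst ((move n E P ^^ (n - 1)) (expand E (\<lambda>_. -2) r, None, q))"

definition won :: "nat \<Rightarrow> nat \<Rightarrow> (nat \<Rightarrow> int) \<Rightarrow> bool" where
  "won n k col \<longleftrightarrow> k \<le> card {v. v < n \<and> 0 \<le> col v}"

definition inner :: "nat \<Rightarrow> (nat \<Rightarrow> int) \<Rightarrow> nat set" where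
  "inner n col = {v. v < n \<and> col v = -1}"

lemma pick_blue:
  assumes "\<exists>v<n. col v = 1"
  shows "pick n col < n" "col (pick n col) = 1"
proof -
  from assms obtain v where v: "v < n" "col v = 1" by blast
  then have "pick n col \<le> v" unfolding pick_def by (intro Least_le) simp
  with v show "pick n col < n" by simp
  moreover have "pick n col < n \<longrightarrow> col (pick n col) = 1"
    unfolding pick_def by (rule LeastI[of _ v]) (simp add: v)
  ultimately show "col (pick n col) = 1" by simp
qed

lemma pick_none:
  assumes "\<not> (\<exists>v<n. col v = 1)"
  shows "pick n col = n"
  unfolding pick_def using assms by (intro Least_equality) (auto simp: not_le)

section \<open>Soundness: every run describes a connected set and its boundary\<close>

locale numbered_graph =
  fixes n :: nat and E :: "nat set set"
  assumes simple: "simple_graph {..<n} E"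
begin

abbreviation bd :: "nat set \<Rightarrow> nat set" where
  "bd \<equiv> boundary {..<n} E"

lemma edge: "{x, y} \<in> E \<Longrightarrow> x < n \<and> y < n \<and> x \<noteq> y"
  using simple unfolding simple_graph_def by fastforce

text \<open>Leaves, decided or not, are exactly the boundary of the inner vertices; therefore
  counting colours measures the boundary.\<close>

definition sound :: "nat \<Rightarrow> (nat \<Rightarrow> int) \<Rightarrow> nat option \<Rightarrow> bool" where
  "sound r col f \<longleftrightarrow> (\<forall>v<n. col v \<in> {-2, -1, 0, 1}) \<and> rooted E r (inner n col) \<and>
     (\<forall>v<n. 0 \<le> col v \<longleftrightarrow> v \<in> bd (inner n col)) \<and> (\<forall>w. f = Some w \<longrightarrow> w < n \<and> col w = 1)"

lemma soundD:
  assumes "sound r col f"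
  shows "v < n \<Longrightarrow> col v \<in> {-2, -1, 0, 1}" "rooted E r (inner n col)"
    "v < n \<Longrightarrow> 0 \<le> col v \<longleftrightarrow> v \<in> bd (inner n col)"
    "f = Some w \<Longrightarrow> w < n \<and> col w = 1"
  using assms unfolding sound_def by blast+

lemma bd_inner:
  assumes "sound r col f"
  shows "{v. v < n \<and> 0 \<le> col v} = bd (inner n col)"
  using assms by (auto simp: sound_def boundary_def)

lemma finite_bd [simp]: "finite (bd I)"
  by (simp add: boundary_def)

lemma fresh_lt: "v \<in> fresh E col u \<Longrightarrow> v < n \<and> v \<noteq> u"
  using edge by (auto simp: fresh_def)

lemma no_loop [simp]: "{x} \<notin> E"
  using edge[of x x] by auto

lemma fresh_self [simp]: "u \<notin> fresh E col u"
  using fresh_lt by blast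

lemma fresh_col: "v \<in> fresh E col u \<Longrightarrow> col v = -2"
  by (simp add: fresh_def)

lemma finite_fresh [simp]: "finite (fresh E col u)"
  by (rule finite_subset[of _ "{..<n}"]) (use fresh_lt in auto)

lemma fresh_n [simp]: "fresh E col n = {}"
  using edge by (fastforce simp: fresh_def)

lemma forced_SomeD:
  assumes "forced E col u = Some w"
  shows "fresh E col u = {w}"
proof -
  have "card (fresh E col u) = 1" "w = the_elem (fresh E col u)"
    using assms by (auto simp: forced_def split: if_splits)
  then show ?thesis by (metis card_1_singletonE the_elem_eq)
qed

lemma inner_expand:
  assumes "u < n"
  shows "inner n (expand E col u) = insert u (inner n col)"
  using assms fresh_col by (force simp: inner_def expand_def)

text \<open>In a sound colouring a neighbour of \<open>u\<close> that is not fresh is inner or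
  already in the boundary.\<close>

lemma bd_insert:
  assumes s: "sound r col f" and u: "u < n" "col u = 1"
  shows "bd (insert u (inner n col)) = fresh E col u \<union> (bd (inner n col) - {u})"
proof (rule set_eqI)
  fix v
  have c: "v < n \<Longrightarrow> v \<notin> inner n col \<Longrightarrow> v \<notin> bd (inner n col) \<Longrightarrow> col v = -2"
    using soundD(1,3)[OF s, of v] by (auto simp: inner_def)
  have f: "v \<in> fresh E col u \<Longrightarrow> v < n \<and> v \<noteq> u \<and> v \<notin> inner n col"
    using fresh_lt by (auto simp: fresh_def inner_def)
  show "v \<in> bd (insert u (inner n col)) \<longleftrightarrow> v \<in> fresh E col u \<union> (bd (inner n col) - {u})"
    using c f by (auto simp: boundary_def fresh_def)
qed

lemma card_bd_insert:
  assumes s: "sound r col f" and u: "u < n" "col u = 1"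
  shows "Suc (card (bd (insert u (inner n col)))) = card (fresh E col u) + card (bd (inner n col))"
proof -
  have "u \<in> bd (inner n col)" using soundD(3)[OF s u(1)] u(2) by simp
  then have "Suc (card (bd (inner n col) - {u})) = card (bd (inner n col))"
    by (intro card_Suc_Diff1) simp_all
  moreover have "fresh E col u \<inter> (bd (inner n col) - {u}) = {}"
    using soundD(3)[OF s] fresh_lt fresh_col by force
  ultimately show ?thesis unfolding bd_insert[OF assms] by (simp add: card_Un_disjoint)
qed

lemma sound_expand:
  assumes s: "sound r col f" and u: "u < n" "col u = 1"
  shows "sound r (expand E col u) (forced E col u)"
proof -
  have "u \<in> bd (inner n col)" using soundD(3)[OF s u(1)] u(2) by simp
  then obtain x where "x \<in> inner n col" "{x, u} \<in> E" by (auto simp: boundary_def)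
  then have "rooted E r (insert u (inner n col))"
    using rooted_insert[OF soundD(2)[OF s]] by blast
  moreover have "0 \<le> expand E col u v \<longleftrightarrow> v \<in> fresh E col u \<union> (bd (inner n col) - {u})"
    if "v < n" for v
    using soundD(3)[OF s that] by (simp add: expand_def)
  moreover have "expand E col u v \<in> {-2, -1, 0, 1}" if "v < n" for v
    using soundD(1)[OF s that] by (simp add: expand_def)
  moreover have "w < n \<and> expand E col u w = 1" if "forced E col u = Some w" for w
    using forced_SomeD[OF that] fresh_lt[of w col u] by (simp add: expand_def)
  ultimately show ?thesis
    unfolding sound_def inner_expand[OF u(1)] bd_insert[OF assms] by blast
qed

lemma sound_cong:
  assumes "sound r col f" "\<And>v. v < n \<Longrightarrow> col' v = col v" "f' = None"
  shows "sound r col' f'"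
proof -
  have "inner n col' = inner n col" using assms by (auto simp: inner_def)
  then show ?thesis using assms unfolding sound_def by auto
qed

lemma sound_red:
  assumes s: "sound r col f" and u: "u < n \<Longrightarrow> col u = 1"
  shows "inner n (col(u := 0)) = inner n col" "sound r (col(u := 0)) None"
proof -
  show i: "inner n (col(u := 0)) = inner n col" using u by (auto simp: inner_def)
  show "sound r (col(u := 0)) None" using s u unfolding sound_def i by auto
qed

lemma sound_move:
  assumes "sound r col f" "move n E P (col, f, q) = (col', f', q')"
  shows "sound r col' f'"
proof (cases f)
  case (Some w)
  then show ?thesis using assms sound_expand[OF assms(1)] by (auto simp: sound_def)
next
  case None
  show ?thesis
  proof (cases "\<exists>v<n. col v = 1")
    case True
    note p = pick_blue[OF this]
    show ?thesis using assms None sound_expand[OF assms(1) p] sound_red(2)[OF assms(1), of "pick n col"] p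
      by (auto split: if_splits)
  next
    case False
    \<comment> \<open>The vertex acted upon is now \<open>n\<close>, which has no neighbours and
      whose colour is never inspected, so the move is idle.\<close>
    note p = pick_none[OF this]
    have "sound r (expand E col n) (forced E col n)"
      using assms(1) by (rule sound_cong) (auto simp: expand_def forced_def)
    moreover have "sound r (col(n := 0)) None" using assms(1) by (rule sound_cong) auto
    ultimately show ?thesis using assms(2) None p by (auto split: if_splits)
  qed
qed

lemma sound_start:
  assumes r: "r < n"
  shows "sound r (expand E (\<lambda>_. -2) r) None" "inner n (expand E (\<lambda>_. -2) r) = {r}"
proof -
  show i: "inner n (expand E (\<lambda>_. -2) r) = {r}"
    using inner_expand[OF r] by (simp add: inner_def)
  have "rooted E r {r}" by (simp add: rooted_def)
  then show "sound r (expand E (\<lambda>_. -2) r) None"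
    unfolding sound_def i using edge by (auto simp: expand_def fresh_def boundary_def)
qed

lemma sound_funpow:
  assumes "sound r (fst st) (fst (snd st))"
  shows "sound r (fst ((move n E P ^^ i) st)) (fst (snd ((move n E P ^^ i) st)))"
proof (induction i)
  case (Suc i)
  obtain col f q where st: "(move n E P ^^ i) st = (col, f, q)" by (rule prod_cases3)
  obtain col' f' q' where st': "move n E P (col, f, q) = (col', f', q')" by (rule prod_cases3)
  have "sound r col f" using Suc by (simp add: st)
  from sound_move[OF this st'] show ?case by (simp add: st st')
qed (simp add: assms)

lemma run_sound:
  assumes "r < n" "won n k (run n E P r q)"
  shows "\<exists>I. I \<subseteq> {..<n} \<and> rooted E r I \<and> k \<le> card (bd I)"
proof -
  obtain f where s: "sound r (run n E P r q) f"
    using sound_funpow[of r "(expand E (\<lambda>_. -2) r, None, q)"] sound_start[OF assms(1)]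
    by (auto simp: run_def)
  have "k \<le> card (bd (inner n (run n E P r q)))"
    using assms(2) bd_inner[OF s] by (simp add: won_def)
  moreover have "rooted E r (inner n (run n E P r q))" using s by (simp add: sound_def)
  moreover have "inner n (run n E P r q) \<subseteq> {..<n}" by (auto simp: inner_def)
  ultimately show ?thesis by blast
qed

end

section \<open>Completeness: decisions that lead to an inclusion-minimal target set\<close>

locale minimal_tree = numbered_graph +
  fixes k :: nat and r :: nat and J :: "nat set"
  assumes J: "J \<subseteq> {..<n}" "rooted E r J" "k \<le> card (bd J)"
    and minimal: "\<And>I. I \<subset> J \<Longrightarrow> rooted E r I \<Longrightarrow> card (bd I) < k"
begin

text \<open>All decisions so far agree with the target: nothing outside \<open>J\<close> became
  inner and nothing in \<open>J\<close> was fixed as a leaf.\<close>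

definition guided :: "(nat \<Rightarrow> int) \<Rightarrow> nat option \<Rightarrow> bool" where
  "guided col f \<longleftrightarrow> sound r col f \<and> inner n col \<subseteq> J \<and> (\<forall>v\<in>J. col v \<noteq> 0) \<and>
     (\<forall>w. f = Some w \<longrightarrow> w \<in> J)"

definition red :: "(nat \<Rightarrow> int) \<Rightarrow> nat set" where
  "red col = {v. v < n \<and> col v = 0}"

definition settled :: "(nat \<Rightarrow> int) \<Rightarrow> nat set" where
  "settled col = {v. v < n \<and> (col v = 0 \<or> col v = -1)}"

text \<open>The potential behind the bound \<open>2 * k\<close>, where \<open>L\<close> is the
  number of digits still available. A pending forced vertex counts one, because the expansion that
  created it did not enlarge the boundary. Before \<open>J\<close> is reached, both cardinalities
  are below \<open>k\<close>, so \<open>L\<close> is positive whenever a branching is due.\<close>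

definition budget :: "nat \<Rightarrow> (nat \<Rightarrow> int) \<Rightarrow> nat option \<Rightarrow> bool" where
  "budget L col f \<longleftrightarrow> (inner n col \<noteq> J \<longrightarrow>
     2 * k \<le> L + card (red col) + card (bd (inner n col)) + (if f = None then 0 else 1))"

text \<open>\<open>i\<close> is the number of moves left. The second disjunct describes a run that
  has no choices left and only idles.\<close>

definition progress :: "nat \<Rightarrow> (nat \<Rightarrow> int) \<Rightarrow> nat option \<Rightarrow> bool" where
  "progress i col f \<longleftrightarrow> n \<le> i + card (settled col) \<or> f = None \<and> \<not> (\<exists>v<n. col v = 1)"

lemma finite_settled [simp]: "finite (settled col)" and finite_red [simp]: "finite (red col)"
  by (simp_all add: settled_def red_def)

lemma guidedD:
  assumes "guided col f"
  shows "sound r col f" "inner n col \<subseteq> J" "v \<in> J \<Longrightarrow> col v \<noteq> 0" "f = Some w \<Longrightarrow> w \<in> J"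
  using assms unfolding guided_def by blast+

text \<open>Otherwise an edge leads from the inner vertices to a further vertex of \<open>J\<close>.
  It lies in the boundary, so it is a leaf, and being in \<open>J\<close> it is not a final one;
  thus it is undecided.\<close>

lemma inner_eq:
  assumes g: "guided col f" and nb: "\<not> (\<exists>v<n. col v = 1)"
  shows "inner n col = J"
proof (rule ccontr)
  assume "inner n col \<noteq> J"
  then obtain v where v: "v \<in> J" "v \<notin> inner n col" using guidedD(2)[OF g] by blast
  note s = guidedD(1)[OF g]
  have "r \<in> inner n col" using soundD(2)[OF s] by (simp add: rooted_def)
  moreover have "(r, v) \<in> (inside E J)\<^sup>*" using J(2) v(1) by (simp add: rooted_def)
  ultimately obtain x y where xy: "{x, y} \<in> E" "x \<in> inner n col" "y \<in> J" "y \<notin> inner n col"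
    using crossing_edge[OF _ _ v(2)] by blast
  then have "y < n" using edge by blast
  moreover from this xy have "y \<in> bd (inner n col)" unfolding boundary_def by blast
  ultimately have y: "y < n" "0 \<le> col y" "col y \<in> {-2, -1, 0, 1}"
    using soundD(1,3)[OF s, of y] by blast+
  moreover have "col y \<noteq> 0" using guidedD(3)[OF g xy(3)] .
  ultimately have "col y = 1" by auto
  with nb y show False by blast
qed

lemma won_if_no_blue:
  assumes g: "guided col f" and nb: "\<not> (\<exists>v<n. col v = 1)"
  shows "won n k col"
proof -
  from bd_inner[OF guidedD(1)[OF g]] inner_eq[OF assms] J(3) show ?thesis by (simp add: won_def)
qed

text \<open>Otherwise \<open>rooted_remove\<close> yields \<open>J - {u}\<close>, a smaller set with
  a boundary that is large enough, against minimality. This justifies forcing a single new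
  neighbour.\<close>

lemma fresh_minimal:
  assumes g: "guided col f" and u: "u < n" "col u = 1" "u \<in> J"
  shows "card (fresh E col u) > 1 \<or> card (fresh E col u) = 1 \<and> fresh E col u \<subseteq> J"
proof (rule ccontr)
  assume "\<not> ?thesis"
  then have c: "card (fresh E col u) \<le> 1" "card (fresh E col u) = 1 \<longrightarrow> \<not> fresh E col u \<subseteq> J" by auto
  have d: "fresh E col u \<inter> J = {}"
  proof (cases "card (fresh E col u) = 1")
    case True
    with c(2) show ?thesis by (auto simp: card_1_singleton_iff)
  next
    case False
    with c(1) have "card (fresh E col u) = 0" by linarith
    then show ?thesis by simp
  qed
  note s = guidedD(1)[OF g]
  have ub: "u \<in> bd (inner n col)" using soundD(3)[OF s u(1)] u(2) by simp
  have *: "fresh E col u = {v. {u, v} \<in> E} - inner n col - bd (inner n col)"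
  proof (intro equalityI subsetI)
    fix v assume "v \<in> fresh E col u"
    then have "v < n" "{u, v} \<in> E" "col v = -2" using fresh_lt by (auto simp: fresh_def)
    then show "v \<in> {v. {u, v} \<in> E} - inner n col - bd (inner n col)"
      using soundD(3)[OF s, of v] by (auto simp: inner_def)
  next
    fix v assume v: "v \<in> {v. {u, v} \<in> E} - inner n col - bd (inner n col)"
    then have "v < n" "{u, v} \<in> E" using edge by auto
    moreover have "\<not> 0 \<le> col v" "col v \<in> {-2, -1, 0, 1}" "col v \<noteq> -1"
      using soundD(1,3)[OF s, of v] v \<open>v < n\<close> by (simp_all add: inner_def)
    ultimately show "v \<in> fresh E col u" by (auto simp: fresh_def)
  qed
  have sub: "inner n col \<subseteq> J" and ro: "rooted E r (inner n col)"
    using guidedD(2)[OF g] soundD(2)[OF s] by blast+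
  have "rooted E r (J - {u})" "card (bd J) \<le> card (bd (J - {u}))"
    using rooted_remove[OF sub ro J(2,1) ub _ * d c(1)] edge by auto
  with minimal[of "J - {u}"] u(3) J(3) show False by auto
qed

text \<open>\<open>Suc L\<close> serves both kinds of expansion: at a branching the extra unit is
  the digit just read, at a forced move it is the unit granted to the pending vertex. Two or more
  new neighbours enlarge the boundary; a single one leaves its size unchanged but is forced next and
  carries the unit on.\<close>

lemma guided_expand:
  assumes g: "guided col f" and u: "u < n" "col u = 1" "u \<in> J"
    and b: "2 * k \<le> Suc L + card (red col) + card (bd (inner n col))"
    and p: "n \<le> Suc i + card (settled col)"
  shows "guided (expand E col u) (forced E col u)" "budget L (expand E col u) (forced E col u)"
    "progress i (expand E col u) (forced E col u)"
proof -
  note s = guidedD(1)[OF g]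
  have "expand E col u v \<noteq> 0" if "v \<in> J" for v
    using guidedD(3)[OF g that] by (simp add: expand_def)
  moreover have "w \<in> J" if "forced E col u = Some w" for w
    using forced_SomeD[OF that] fresh_minimal[OF g u] by auto
  ultimately show "guided (expand E col u) (forced E col u)"
    using sound_expand[OF s u(1,2)] guidedD(2)[OF g] u(3)
    unfolding guided_def inner_expand[OF u(1)] by blast
  have red: "red (expand E col u) = red col"
    using u by (auto simp: red_def expand_def fresh_def)
  have "settled (expand E col u) = insert u (settled col)"
    using u fresh_col by (force simp: settled_def expand_def)
  moreover have "u \<notin> settled col" using u by (simp add: settled_def)
  ultimately show "progress i (expand E col u) (forced E col u)"
    using p by (simp add: progress_def)
  have "forced E col u \<noteq> None" if "card (fresh E col u) = 1"
    using that by (simp add: forced_def)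
  then show "budget L (expand E col u) (forced E col u)"
    using b fresh_minimal[OF g u] card_bd_insert[OF s u(1,2)]
    unfolding budget_def red inner_expand[OF u(1)] by (auto simp: forced_def)
qed

text \<open>The truncated \<open>L - 1\<close> is intended: when the digits are used up, zeros
  follow for ever, and fixing a leaf increases \<open>red\<close> anyway. The case
  \<open>pick n col = n\<close> is included, where \<open>inner_eq\<close> makes the budget
  vacuous.\<close>

lemma guided_red:
  assumes g: "guided col None" and u: "pick n col \<notin> J"
    and b: "budget L col None" and p: "progress (Suc i) col None"
  shows "guided (col(pick n col := 0)) None" "budget (L - 1) (col(pick n col := 0)) None"
    "progress i (col(pick n col := 0)) None"
proof -
  let ?u = "pick n col"
  let ?c = "col(?u := 0)"
  note s = guidedD(1)[OF g]
  have blue: "?u < n \<Longrightarrow> col ?u = 1" using pick_blue(2) pick_none by (metis less_irrefl)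
  have i: "inner n ?c = inner n col" "sound r ?c None"
    using sound_red[OF s, of ?u] blue by blast+
  show "guided ?c None"
    unfolding guided_def i(1) using i(2) guidedD(2,3)[OF g] u by auto
  show "budget (L - 1) ?c None"
  proof (cases "\<exists>v<n. col v = 1")
    case True
    note p = pick_blue[OF this]
    have "red ?c = insert ?u (red col)" "?u \<notin> red col" using p by (auto simp: red_def)
    then show ?thesis using b unfolding budget_def i(1) by auto
  next
    case False
    from inner_eq[OF g this] show ?thesis unfolding budget_def i(1) by simp
  qed
  show "progress i ?c None"
  proof (cases "\<exists>v<n. col v = 1")
    case True
    note q = pick_blue[OF this]
    have "settled ?c = insert ?u (settled col)" "?u \<notin> settled col"
      using q by (auto simp: settled_def)
    then show ?thesis using p True by (auto simp: progress_def)
  next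
    case False
    then show ?thesis by (auto simp: progress_def)
  qed
qed

text \<open>Divisibility by \<open>2 ^ (K - L)\<close> says that at most the \<open>L\<close>
  leading of the \<open>K\<close> digits are nonzero. Prepending the digit 0 is halving.\<close>

lemma digit_0:
  assumes "0 \<le> q" "q < 2 ^ K" "2 ^ (K - (L - 1)) dvd q" "L \<le> K"
  shows "\<exists>q'::int. 0 \<le> q' \<and> q' < 2 ^ K \<and> 2 ^ (K - L) dvd q' \<and> 2 * q' = q"
proof (cases L)
  case 0
  \<comment> \<open>A multiple of \<open>2 ^ K\<close> below \<open>2 ^ K\<close> is 0, which
    supplies zeros without end.\<close>
  then have "q = 0" using assms zdvd_imp_le[of "2 ^ K" q] by (cases "q = 0") auto
  then show ?thesis by (intro exI[of _ 0]) simp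
next
  case (Suc l)
  then have "K - (L - 1) = Suc (K - L)" using assms by simp
  with assms obtain z where z: "q = 2 ^ Suc (K - L) * z" by (metis dvdE)
  define p where "p = 2 ^ (K - L) * z"
  have "q = 2 * p" "2 ^ (K - L) dvd p" using z by (simp_all add: p_def)
  then show ?thesis using assms by (intro exI[of _ p]) auto
qed

text \<open>Prepending the digit 1 is halving and adding \<open>2 ^ (K - 1)\<close>; the doubling in
  \<open>move\<close> undoes this.\<close>

lemma digit_1:
  assumes "0 \<le> q" "q < 2 ^ K" "2 ^ (K - (L - 1)) dvd q" "L \<le> K" "L > 0"
  shows "\<exists>q'::int. 0 \<le> q' \<and> q' < 2 ^ K \<and> 2 ^ (K - L) dvd q' \<and> 2 * q' = q + 2 ^ K"
proof -
  from digit_0[OF assms(1-4)] obtain q' where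
    q': "0 \<le> q'" "2 ^ (K - L) dvd q'" "2 * q' = q" by blast
  have "(2::int) ^ K = 2 * 2 ^ (K - 1)" using assms by (cases K) auto
  moreover have "(2::int) ^ (K - L) dvd 2 ^ (K - 1)" using assms by (intro le_imp_power_dvd) simp
  ultimately show ?thesis using q' assms by (intro exI[of _ "q' + 2 ^ (K - 1)"]) auto
qed

text \<open>\<open>q\<close> is composed from the last move backwards: the induction gives the
  digits for the remaining moves, and the present decision, dictated by membership of the chosen
  vertex in \<open>J\<close>, is prepended. Forced moves consume no digit.\<close>

lemma guided_run:
  assumes "guided col f" "budget L col f" "progress i col f" "L \<le> K"
  shows "\<exists>q. 0 \<le> q \<and> q < 2 ^ K \<and> 2 ^ (K - L) dvd q \<and>
    won n k (fst ((move n E (2 ^ K) ^^ i) (col, f, q)))"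
  using assms
proof (induction i arbitrary: col f L)
  case (0 col f L)
  have "\<not> (\<exists>v<n. col v = 1)"
  proof
    assume "\<exists>v<n. col v = 1"
    then obtain v where v: "v < n" "col v = 1" by blast
    with 0 have "n \<le> card (settled col)" by (auto simp: progress_def)
    moreover have "settled col \<subseteq> {..<n} - {v}" using v by (auto simp: settled_def)
    then have "card (settled col) \<le> card ({..<n} - {v})" by (intro card_mono) auto
    ultimately show False using v by simp
  qed
  from won_if_no_blue[OF 0(1) this] have "won n k col" .
  then show ?case by (intro exI[of _ 0]) simp
next
  case (Suc i col f L)
  note s = guidedD(1)[OF Suc.prems(1)]
  show ?case
  proof (cases f)
    case (Some w)
    have w: "w < n" "col w = 1" "w \<in> J" 
      using guidedD(4)[OF Suc.prems(1) Some] soundD(4)[OF s Some] by blast+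
    have "inner n col \<noteq> J" using w by (auto simp: inner_def)
    then have "2 * k \<le> Suc L + card (red col) + card (bd (inner n col))"
      using Suc.prems(2) Some by (simp add: budget_def)
    moreover have "n \<le> Suc i + card (settled col)"
      using Suc.prems(3) Some by (simp add: progress_def)
    ultimately have "\<exists>q. 0 \<le> q \<and> q < 2 ^ K \<and> 2 ^ (K - L) dvd q \<and>
      won n k (fst ((move n E (2 ^ K) ^^ i) (expand E col w, forced E col w, q)))"
      by (intro Suc.IH Suc.prems(4) guided_expand[OF Suc.prems(1) w])
    then obtain q where "0 \<le> q" "q < 2 ^ K" "2 ^ (K - L) dvd q"
      "won n k (fst ((move n E (2 ^ K) ^^ i) (expand E col w, forced E col w, q)))" by blast
    then show ?thesis using Some by (intro exI[of _ q]) (simp add: funpow_Suc_right del: funpow.simps)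
  next
    case None
    let ?u = "pick n col"
    show ?thesis
    proof (cases "?u \<in> J")
      case False
      from guided_red[OF _ this] Suc.prems None
      have "guided (col(?u := 0)) None" "budget (L - 1) (col(?u := 0)) None"
        "progress i (col(?u := 0)) None" by auto
      from Suc.IH[OF this le_trans[OF diff_le_self Suc.prems(4)]] obtain q where
        q: "0 \<le> q" "q < 2 ^ K" "2 ^ (K - (L - 1)) dvd q"
          "won n k (fst ((move n E (2 ^ K) ^^ i) (col(?u := 0), None, q)))" by blast
      from digit_0[OF q(1-3) Suc.prems(4)] obtain q' where
        q': "0 \<le> q'" "q' < 2 ^ K" "2 ^ (K - L) dvd q'" "2 * q' = q" by blast
      with q None have "move n E (2 ^ K) (col, f, q') = (col(?u := 0), None, q)" by simp
      with q q' show ?thesis by (intro exI[of _ q']) (simp add: funpow_Suc_right del: funpow.simps)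
    next
      case True
      then have "?u < n" using J(1) by auto
      then have b: "\<exists>v<n. col v = 1" using pick_none by (metis less_irrefl)
      note u = pick_blue[OF b] True
      have ne: "inner n col \<noteq> J" using u by (auto simp: inner_def)
      then have "inner n col \<subset> J" using guidedD(2)[OF Suc.prems(1)] by blast
      from minimal[OF this soundD(2)[OF s]] have lt: "card (bd (inner n col)) < k" .
      \<comment> \<open>Final leaves belong to the boundary, which minimality keeps below
        \<open>k\<close>; so the budget leaves a digit for this branching.\<close>
      have "red col \<subseteq> bd (inner n col)" using soundD(3)[OF s] unfolding red_def by force
      then have "card (red col) < k" using lt card_mono[of "bd (inner n col)" "red col"] by simp
      then have L: "L > 0" "2 * k \<le> Suc (L - 1) + card (red col) + card (bd (inner n col))"
        using Suc.prems(2) None ne lt by (auto simp: budget_def)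
      have "n \<le> Suc i + card (settled col)" using Suc.prems(3) b by (auto simp: progress_def)
      from Suc.IH[OF guided_expand[OF Suc.prems(1) u L(2) this] le_trans[OF diff_le_self Suc.prems(4)]]
      obtain q where
        q: "0 \<le> q" "q < 2 ^ K" "2 ^ (K - (L - 1)) dvd q"
          "won n k (fst ((move n E (2 ^ K) ^^ i) (expand E col ?u, forced E col ?u, q)))" by blast
      from digit_1[OF q(1-3) Suc.prems(4) L(1)] obtain q' where
        q': "0 \<le> q'" "q' < 2 ^ K" "2 ^ (K - L) dvd q'" "2 * q' = q + 2 ^ K" by blast
      with q None have "move n E (2 ^ K) (col, f, q') = (expand E col ?u, forced E col ?u, q)" by simp
      with q q' show ?thesis by (intro exI[of _ q']) (simp add: funpow_Suc_right del: funpow.simps)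
    qed
  qed
qed

end

theorem (in numbered_graph) run_correct:
  "(\<exists>r<n. \<exists>q. 0 \<le> q \<and> q < 2 ^ (2 * k) \<and> won n k (run n E (2 ^ (2 * k)) r q)) \<longleftrightarrow>
    (\<exists>r I. I \<subseteq> {..<n} \<and> rooted E r I \<and> k \<le> card (bd I))"
proof
  assume "\<exists>r I. I \<subseteq> {..<n} \<and> rooted E r I \<and> k \<le> card (bd I)"
  then obtain r I where I: "I \<subseteq> {..<n} \<and> rooted E r I \<and> k \<le> card (bd I)" by blast
  obtain J where J: "J \<subseteq> {..<n}" "rooted E r J" "k \<le> card (bd J)" and
    least: "\<And>I. I \<subseteq> {..<n} \<and> rooted E r I \<and> k \<le> card (bd I) \<Longrightarrow> card J \<le> card I"
    \<comment> \<open>Least cardinality for the fixed root \<open>r\<close> gives the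
      inclusion-minimality that the locale demands.\<close>
    using ex_has_least_nat[of "\<lambda>I. I \<subseteq> {..<n} \<and> rooted E r I \<and> k \<le> card (bd I)", OF I, of card]
    by blast
  have minimal: "card (bd I) < k" if I: "I \<subset> J" "rooted E r I" for I
  proof -
    have "finite J" using J(1) finite_subset by blast
    then have "card I < card J" using I(1) by (rule psubset_card_mono)
    moreover have "I \<subseteq> {..<n}" using I(1) J(1) by blast
    ultimately show ?thesis using least[of I] I(2) by linarith
  qed
  interpret minimal_tree n E k r J by unfold_locales (fact J minimal)+
  have r: "r \<in> J" "r < n" using J by (auto simp: rooted_def)
  let ?col = "expand E (\<lambda>_. -2) r"
  have "?col v \<noteq> 0" for v by (simp add: expand_def)
  then have "guided ?col None"
    using sound_start[OF r(2)] r(1) by (simp add: guided_def)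
  moreover have "budget (2 * k) ?col None" by (simp add: budget_def)
  moreover have "progress (n - 1) ?col None"
  proof -
    have "{r} \<subseteq> settled ?col" using r(2) fresh_self[of r "\<lambda>_. -2"]
      by (simp add: settled_def expand_def)
    then have "card {r} \<le> card (settled ?col)" using finite_settled by (intro card_mono) auto
    then have "n \<le> n - 1 + card (settled ?col)" by simp
    then show ?thesis by (simp add: progress_def)
  qed
  ultimately have "\<exists>q. 0 \<le> q \<and> q < 2 ^ (2 * k) \<and> 2 ^ (2 * k - 2 * k) dvd q \<and>
      won n k (fst ((move n E (2 ^ (2 * k)) ^^ (n - 1)) (?col, None, q)))"
    by (rule guided_run) simp
  then have "\<exists>q. 0 \<le> q \<and> q < 2 ^ (2 * k) \<and> won n k (run n E (2 ^ (2 * k)) r q)"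
    unfolding run_def by (elim exE conjE) (intro exI conjI)
  with r(2) show "\<exists>r<n. \<exists>q. 0 \<le> q \<and> q < 2 ^ (2 * k) \<and> won n k (run n E (2 ^ (2 * k)) r q)" by blast
next
  assume "\<exists>r<n. \<exists>q. 0 \<le> q \<and> q < 2 ^ (2 * k) \<and> won n k (run n E (2 ^ (2 * k)) r q)"
  then obtain r q where "r < n" "won n k (run n E (2 ^ (2 * k)) r q)" by blast
  then show "\<exists>r I. I \<subseteq> {..<n} \<and> rooted E r I \<and> k \<le> card (bd I)"
    by (intro exI[of _ r] run_sound)
qed

section \<open>The program\<close>

lemma wp_conseq:
  "wp c Q s \<Longrightarrow> (\<And>R xs t. Q (R, xs, t) \<Longrightarrow> Q' (R, xs, t)) \<Longrightarrow> wp c Q' s"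
  by (erule wp_mono) (metis prod_cases3)

text \<open>
  Registers 0 to 4 hold constants, 5 to 8 hold \<open>n\<close>, the number of arcs (twice the number of edges),
  \<open>k\<close> and \<open>P\<close>, 9 the answer, 10 and 11 the root and the number \<open>q\<close> encoding the decisions.
  Register \<open>100 + v\<close> holds the colour of \<open>v\<close>; the ends of arc \<open>j\<close> are in registers \<open>-2j - 1\<close> and \<open>-2j - 2\<close>.
\<close>

definition scan :: com where
  "scan = Ins (Add 17 5 1) ;; Ins (Add 13 5 1) ;;
     For 13 (Ins (Add 14 4 13) ;; Ins (Load 16 14) ;; When 16 (Ins (Add 17 13 1)))"

text \<open>Equality of the arc's tail with \<open>u\<close> is tested by two subtractions, and
  \<open>-1\<close> minus the colour is positive only for \<open>-2\<close>. Register 20 counts the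
  new neighbours and 18 keeps the latest one, which is the forced vertex if the count is 1.\<close>

definition expand_code :: com where
  "expand_code = Ins (Add 14 4 17) ;; Ins (Store 14 2) ;; Ins (Add 23 2 1) ;; Ins (Add 13 6 1) ;;
     For 13 (Ins (Load 24 23) ;; Ins (Add 23 23 2) ;; Ins (Load 25 23) ;; Ins (Add 23 23 2) ;;
       Ins (Sub 15 24 17) ;; Unless 15 (Ins (Sub 15 17 24) ;; Unless 15
         (Ins (Add 14 4 25) ;; Ins (Load 16 14) ;; Ins (Sub 16 2 16) ;;
          When 16 (Ins (Store 14 0) ;; Ins (Add 20 20 0) ;; Ins (Add 18 25 1)))))"

definition decide :: com where
  "decide = scan ;; Ins (Add 21 21 21) ;; Ins (Sub 16 21 8) ;; Ins (Add 16 16 0) ;;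
     Ins (Const 22 0) ;; When 16 (Ins (Sub 21 21 8) ;; Ins (Const 22 1))"

text \<open>The closing tests set the flag in register 19 exactly when the count in register 20 is
  1.\<close>

definition move_code :: com where
  "move_code = When 19 (Ins (Add 17 18 1) ;; Ins (Const 22 1)) ;; Unless 19 decide ;;
     When 22 expand_code ;; Unless 22 (Ins (Add 14 4 17) ;; Ins (Store 14 1)) ;;
     Ins (Const 19 0) ;; Ins (Sub 15 20 0) ;;
     Unless 15 (Ins (Sub 15 0 20) ;; Unless 15 (Ins (Const 19 1))) ;; Ins (Const 20 0)"

definition clear :: com where
  "clear = Ins (Add 13 5 1) ;; For 13 (Ins (Add 14 4 13) ;; Ins (Store 14 3))"

text \<open>Register 9 is set but never reset, so the results of successive simulations accumulate
  as a disjunction.\<close>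

definition tally :: com where
  "tally = Ins (Const 22 0) ;; Ins (Add 13 5 1) ;;
     For 13 (Ins (Add 14 4 13) ;; Ins (Load 16 14) ;; Ins (Add 16 16 0) ;;
       When 16 (Ins (Add 22 22 0))) ;;
     Ins (Sub 16 22 7) ;; Ins (Add 16 16 0) ;; When 16 (Ins (Const 9 1))"

text \<open>Register 20 starts with a value other than 0, so that the root never forces its only
  neighbour to become an inner vertex.\<close>

definition simulate :: com where
  "simulate = clear ;; Ins (Add 18 10 1) ;; Ins (Const 19 1) ;; Ins (Const 20 5) ;;
     Ins (Add 21 11 1) ;; Ins (Add 12 5 1) ;; For 12 move_code ;; tally"

text \<open>Each edge is stored as two opposite arcs, so that comparing tails finds all neighbours.
  \<open>P\<close> arises by doubling 1; a negative \<open>k\<close> gives no rounds and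
  \<open>P = 1\<close>.\<close>

definition initialise :: com where
  "initialise = Ins (Const 0 1) ;; Ins (Const 2 (-1)) ;; Ins (Const 3 (-2)) ;; Ins (Const 4 100) ;;
     Ins (Read 5) ;; Ins (Read 6) ;; Ins (Read 7) ;; Ins (Add 23 2 1) ;; Ins (Add 13 6 1) ;;
     For 13 (Ins (Read 24) ;; Ins (Read 25) ;; Ins (Store 23 24) ;; Ins (Add 23 23 2) ;;
       Ins (Store 23 25) ;; Ins (Add 23 23 2) ;; Ins (Store 23 25) ;; Ins (Add 23 23 2) ;;
       Ins (Store 23 24) ;; Ins (Add 23 23 2)) ;;
     Ins (Add 6 6 6) ;; Ins (Const 8 1) ;; Ins (Add 13 7 7) ;; For 13 (Ins (Add 8 8 8))"

definition search :: com where
  "search = Ins (Add 10 5 1) ;; For 10 (Ins (Add 11 8 1) ;; For 11 simulate)"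

text \<open>A tree with two vertices has two leaves but no inner vertex.\<close>

definition small_case :: com where
  "small_case = Ins (Sub 16 5 0) ;; When 16 (Ins (Const 16 3) ;; Ins (Sub 16 16 5) ;;
     When 16 (Ins (Const 16 3) ;; Ins (Sub 16 16 7) ;; When 16 (Ins (Const 9 1))))"

definition body :: com where
  "body = initialise ;; search ;; small_case"

definition program :: "instr list" where
  "program = compile body 0 @ [JumpPos 9 (code_length body + 2), Halt False, Halt True]"

section \<open>Register contents and their preservation\<close>

definition arcs_at :: "(nat \<times> nat) list \<Rightarrow> (int \<Rightarrow> int) \<Rightarrow> bool" where
  "arcs_at as R \<longleftrightarrow> (\<forall>j<length as.
     R (- (2 * int j + 1)) = int (fst (as ! j)) \<and> R (- (2 * int j + 2)) = int (snd (as ! j)))"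

definition env :: "nat \<Rightarrow> int \<Rightarrow> int \<Rightarrow> (nat \<times> nat) list \<Rightarrow> (int \<Rightarrow> int) \<Rightarrow> bool" where
  "env n k P as R \<longleftrightarrow> R 0 = 1 \<and> R 1 = 0 \<and> R 2 = -1 \<and> R 3 = -2 \<and> R 4 = 100 \<and>
     R 5 = int n \<and> R 6 = int (length as) \<and> R 7 = k \<and> R 8 = P \<and> arcs_at as R"

text \<open>Indices from 100 on hold the colours and are left free; negative indices are covered, so
  the stored arcs are preserved.\<close>

definition agree :: "int set \<Rightarrow> (int \<Rightarrow> int) \<Rightarrow> (int \<Rightarrow> int) \<Rightarrow> bool" where
  "agree X R R' \<longleftrightarrow> (\<forall>i<100. i \<notin> X \<longrightarrow> R' i = R i)"

text \<open>The bounds on the colours allow sign tests to identify them.\<close>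

definition coloured :: "nat \<Rightarrow> (int \<Rightarrow> int) \<Rightarrow> (nat \<Rightarrow> int) \<Rightarrow> bool" where
  "coloured n R col \<longleftrightarrow> (\<forall>v<n. R (100 + int v) = col v \<and> -2 \<le> col v \<and> col v \<le> 1)"

lemma agree_refl [simp]: "agree X R R"
  by (simp add: agree_def)

lemma agree_upd [simp]: "a \<in> X \<or> 100 \<le> a \<Longrightarrow> agree X R R' \<Longrightarrow> agree X R (R'(a := b))"
  by (auto simp: agree_def)

lemma agree_trans: "agree X R R' \<Longrightarrow> agree Y R' R'' \<Longrightarrow> Y \<subseteq> X \<Longrightarrow> agree X R R''"
  by (auto simp: agree_def)

lemma agreeD: "agree X R R' \<Longrightarrow> i < 100 \<Longrightarrow> i \<notin> X \<Longrightarrow> R' i = R i"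
  by (simp add: agree_def)

lemma agree_env:
  assumes "agree X R R'" "env n k P as R" "\<forall>x\<in>X. 9 \<le> x"
  shows "env n k P as R'"
proof -
  have "R' i = R i" if "i < 9" for i
    using assms(1,3) that by (intro agreeD[OF assms(1)]) force+
  then show ?thesis using assms(2) by (simp add: env_def arcs_at_def)
qed

lemma envD:
  assumes "env n k P as R"
  shows "R 0 = 1" "R 1 = 0" "R 2 = -1" "R 3 = -2" "R 4 = 100" "R 5 = int n"
    "R 6 = int (length as)" "R 7 = k" "R 8 = P"
  using assms by (simp_all add: env_def)

lemma coloured_upd [simp]: "a < 100 \<Longrightarrow> coloured n (R(a := b)) col \<longleftrightarrow> coloured n R col"
  by (auto simp: coloured_def)

lemma coloured_store [simp]:
  "-2 \<le> b \<Longrightarrow> b \<le> 1 \<Longrightarrow> coloured n R col \<Longrightarrow> coloured n (R(100 + int v := b)) (col(v := b))"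
  by (auto simp: coloured_def)

lemma colouredD: "coloured n R col \<Longrightarrow> v < n \<Longrightarrow> R (100 + int v) = col v \<and> -2 \<le> col v \<and> col v \<le> 1"
  by (simp add: coloured_def)

section \<open>Correctness and cost of the subroutines\<close>

lemma scan:
  assumes e: "env n k P as R" and c: "coloured n R col"
  shows "wp scan (\<lambda>(R', xs', t'). xs' = xs \<and> agree {13..17} R R' \<and> coloured n R' col \<and>
    R' 17 = int (pick n col) \<and> t' \<le> t + 10 * n + 4) (R, xs, t)"
proof -
  \<comment> \<open>The loop runs downwards and overwrites its result, so the last hit is the least;
    the initial value \<open>n\<close> survives if there is none.\<close>
  define Inv where "Inv i R' xs' t' \<longleftrightarrow> xs' = xs \<and> agree {13..17} R R' \<and> coloured n R' col \<and>
    (\<exists>u. R' 17 = int u \<and> u \<le> n \<and> (u < n \<longrightarrow> col u = 1) \<and> (\<forall>v. i \<le> v \<and> v < u \<longrightarrow> col v \<noteq> 1))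
    \<and> t' + 10 * i \<le> t + 10 * n + 4" for i R' xs' t'
  note [simp] = envD[OF e]
  show ?thesis
  proof (simp add: scan_def, rule wp_For[where Inv = Inv and N = n], goal_cases)
    case 4
    then show ?case using c by (auto simp: Inv_def)
  next
    case i: (5 i R1 xs1 t1)
    then obtain u where u: "R1 17 = int u" "u \<le> n" "u < n \<longrightarrow> col u = 1"
      "\<forall>v. Suc i \<le> v \<and> v < u \<longrightarrow> col v \<noteq> 1" and a: "xs1 = xs" "agree {13..17} R R1"
      "coloured n R1 col" "t1 + 10 * Suc i \<le> t + 10 * n + 4" by (auto simp: Inv_def)
    note [simp] = envD[OF agree_env[OF a(2) e]] a(1)
    have ci: "R1 (100 + int i) = col i" "col i \<le> 1" using colouredD[OF a(3) i(1)] by auto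
    have "\<forall>v. i \<le> v \<and> v < u \<longrightarrow> col v \<noteq> 1" if "col i \<noteq> 1"
      using u(4) that by (metis Suc_leI le_neq_implies_less)
    then show ?case
      using a(2-4) u(1-3) ci i(1) by (auto simp: wp_When Inv_def)
  next
    case (6 R1 xs1 t1)
    then obtain u where u: "R1 17 = int u" "u \<le> n" "u < n \<longrightarrow> col u = 1"
      "\<forall>v<u. col v \<noteq> 1" and a: "xs1 = xs" "agree {13..17} R R1"
      "coloured n R1 col" "t1 \<le> t + 10 * n + 4" by (auto simp: Inv_def)
    have "pick n col = u" unfolding pick_def
      using u by (intro Least_equality) (auto simp: not_le[symmetric])
    then show ?case
      using u(1) a by simp
  qed simp_all
qed


definition fresh_upto :: "(nat \<times> nat) list \<Rightarrow> (nat \<Rightarrow> int) \<Rightarrow> nat \<Rightarrow> nat \<Rightarrow> nat set" where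
  "fresh_upto as col u j = {v. (u, v) \<in> set (take j as) \<and> col v = -2}"

lemma fresh_upto_Suc:
  assumes "j < length as" "as ! j = (a, d)"
  shows "fresh_upto as col u (Suc j) =
    (if a = u \<and> col d = -2 then insert d (fresh_upto as col u j) else fresh_upto as col u j)"
  using assms by (auto simp: fresh_upto_def take_Suc_conv_app_nth)

lemma finite_fresh_upto [simp]: "finite (fresh_upto as col u j)"
  by (rule finite_subset[of _ "snd ` set (take j as)"]) (force simp: fresh_upto_def)+

lemma expand_code:
  assumes e: "env n k P as R" and c: "coloured n R col"
    and u: "R 17 = int u" and x: "R 20 = int x"
    and as: "\<forall>a b. (a, b) \<in> set as \<longleftrightarrow> {a, b} \<in> E"
    and E: "\<forall>a b. {a, b} \<in> E \<longrightarrow> a < n \<and> b < n \<and> a \<noteq> b"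
  shows "wp expand_code (\<lambda>(R', xs', t'). xs' = xs \<and> agree {13, 14, 15, 16, 18, 20, 23, 24, 25} R R' \<and>
    coloured n R' (expand E col u) \<and> R' 20 = int (x + card (fresh E col u)) \<and>
    (fresh E col u \<noteq> {} \<longrightarrow> (\<exists>w\<in>fresh E col u. R' 18 = int w)) \<and>
    t' \<le> t + 30 * length as + 6) (R, xs, t)"
proof -
  let ?X = "{13, 14, 15, 16, 18, 20, 23, 24, 25} :: int set"
  let ?m = "length as"
  define D where "D j = fresh_upto as col u (?m - j)" for j
  \<comment> \<open>The colouring when \<open>j\<close> arcs remain: \<open>expand\<close>
    restricted to the arcs already visited.\<close>
  define pcol where "pcol j = (\<lambda>v. if v \<in> D j then 1 else (col(u := -1)) v)" for j
  define Inv where "Inv j R' xs' t' \<longleftrightarrow> xs' = xs \<and> agree ?X R R' \<and> coloured n R' (pcol j) \<and>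
    R' 20 = int (x + card (D j)) \<and> (D j \<noteq> {} \<longrightarrow> (\<exists>w\<in>D j. R' 18 = int w)) \<and>
    j \<le> ?m \<and> R' 23 = - (2 * int (?m - j) + 1) \<and> t' + 30 * j \<le> t + 30 * ?m + 6" for j R' xs' t'
  note [simp] = envD[OF e] u x
  have D0: "D 0 = fresh E col u" using as by (simp add: D_def fresh_upto_def fresh_def)
  have Dm: "D ?m = {}" by (simp add: D_def fresh_upto_def)
  have Dn: "v \<noteq> u" "v < n" if "v \<in> D j" for v j
    using that as E by (auto simp: D_def fresh_upto_def dest!: in_set_takeD)
  show ?thesis
  proof (simp add: expand_code_def, rule wp_For[where Inv = Inv and N = ?m], goal_cases)
    case 4
    have "pcol ?m = col(u := -1)" by (simp add: pcol_def Dm fun_eq_iff)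
    then show ?case using c by (auto simp: Inv_def Dm)
  next
    case i: (5 i R1 xs1 t1)
    define j where "j = ?m - Suc i"
    obtain a d where ad: "as ! j = (a, d)" by (cases "as ! j")
    have j: "j < ?m" "?m - i = Suc j" using i(1) by (auto simp: j_def)
    have inv: "xs1 = xs" "agree ?X R R1" "coloured n R1 (pcol (Suc i))"
      "R1 20 = int (x + card (D (Suc i)))" "D (Suc i) \<noteq> {} \<longrightarrow> (\<exists>w\<in>D (Suc i). R1 18 = int w)"
      "R1 23 = - (2 * int j + 1)" "t1 + 30 * Suc i \<le> t + 30 * ?m + 6"
      using i(3) by (auto simp: Inv_def j_def)
    note e1 = agree_env[OF inv(2) e]
    have e1': "env n k P as R1" by (rule e1) auto
    have u1: "R1 17 = int u" using agreeD[OF inv(2), of 17] by simp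
    have mem: "R1 (- (2 * int j + 1)) = int a" "R1 (- (2 * int j + 2)) = int d"
      using e1' j(1) ad by (auto simp: env_def arcs_at_def)
    have mem': "R1 (- (2 * int j) - 1) = int a" "R1 (- 2 - 2 * int j) = int d"
    proof -
      have eq: "- (2 * int j) - 1 = - (2 * int j + 1)" "- 2 - 2 * int j = - (2 * int j + 2)"
        by simp_all
      show "R1 (- (2 * int j) - 1) = int a" "R1 (- 2 - 2 * int j) = int d"
        unfolding eq by (rule mem)+
    qed
    have "(a, d) \<in> set as" using ad j(1) nth_mem by fastforce
    then have ad': "a < n" "d < n" "a \<noteq> d" using as E by blast+
    have cd: "R1 (100 + int d) = pcol (Suc i) d" "-2 \<le> pcol (Suc i) d"
      using colouredD[OF inv(3) ad'(2)] by auto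
    have D: "D i = (if a = u \<and> col d = -2 then insert d (D (Suc i)) else D (Suc i))"
      using fresh_upto_Suc[OF j(1) ad, of col u] by (simp add: D_def j j_def[symmetric])
    \<comment> \<open>The machine tests the current colour. A vertex found before has colour 1 and
      is not counted again, and \<open>a \<noteq> d\<close> keeps the recoloured \<open>u\<close>
      out of play.\<close>
    define hit where "hit \<longleftrightarrow> a = u \<and> pcol (Suc i) d = -2"
    have d: "hit \<Longrightarrow> d \<notin> D (Suc i)" by (auto simp: hit_def pcol_def)
    have Di: "D i = (if hit then insert d (D (Suc i)) else D (Suc i))"
      using D ad'(3) by (auto simp: hit_def pcol_def)
    have pi: "pcol i = (if hit then (pcol (Suc i))(d := 1) else pcol (Suc i))"
      by (auto simp: pcol_def Di fun_eq_iff)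
    have fin: "finite (D (Suc i))" by (simp add: D_def)
    note [simp] = envD[OF e1'] inv(1) u1 inv(6) mem'
    show ?case
    proof (cases hit)
      case True
      then have "a = u" "pcol (Suc i) d = -2" by (simp_all add: hit_def)
      then show ?thesis using inv(2-5,7) cd(1) True d fin i(1) j(1)
        by (auto simp: wp_When Inv_def Di pi j(2) branch_def)
    next
      case False
      then have "a = u \<Longrightarrow> pcol (Suc i) d \<ge> -1" using cd by (auto simp: hit_def)
      then show ?thesis using inv(2-5,7) cd(1) False i(1) j(1)
        by (auto simp: wp_When Inv_def Di pi j(2) branch_def)
    qed
  next
    case (6 R1 xs1 t1)
    have "pcol 0 = expand E col u" by (simp add: pcol_def D0 expand_def)
    then show ?case using 6 by (simp add: Inv_def D0)
  qed simp_all
qed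


definition represents :: "nat \<Rightarrow> (int \<Rightarrow> int) \<Rightarrow> bool \<Rightarrow> (nat \<Rightarrow> int) \<times> nat option \<times> int \<Rightarrow> bool" where
  "represents n R first = (\<lambda>(col, f, q). coloured n R col \<and> R 19 = (if f = None then 0 else 1) \<and>
     (\<forall>w. f = Some w \<longrightarrow> R 18 = int w) \<and> R 21 = q \<and> R 20 = (if first then 5 else 0))"

text \<open>Lets the expansion of the root be treated as an ordinary forced move whose own forced
  vertex is discarded.\<close>

definition drop_forced :: "bool \<Rightarrow> 'a \<times> nat option \<times> 'b \<Rightarrow> 'a \<times> nat option \<times> 'b" where
  "drop_forced first = (\<lambda>(col, f, q). (col, if first then None else f, q))"

lemma wp_Unless:
  "wp (Unless x c) Q (R, xs, t) = (if R x > 0 then Q (R, xs, Suc t) else wp c Q (R, xs, Suc t))"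
  by simp

lemma move_tail:
  assumes e: "env n k P as R" and c: "coloured n R col"
    and u: "R 17 = int u" and x: "R 20 = (if first then 5 else 0)"
    and b: "R 22 = (if b then 1 else 0)"
    and as: "\<forall>a b. (a, b) \<in> set as \<longleftrightarrow> {a, b} \<in> E"
    and E: "\<forall>a b. {a, b} \<in> E \<longrightarrow> a < n \<and> b < n \<and> a \<noteq> b"
  shows "wp (When 22 expand_code ;; Unless 22 (Ins (Add 14 4 17) ;; Ins (Store 14 1)) ;;
     Ins (Const 19 0) ;; Ins (Sub 15 20 0) ;;
     Unless 15 (Ins (Sub 15 0 20) ;; Unless 15 (Ins (Const 19 1))) ;; Ins (Const 20 0))
    (\<lambda>(R', xs', t'). xs' = xs \<and> agree {13..25} R R' \<and>
      represents n R' False (drop_forced first (if b then (expand E col u, forced E col u, R 21)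
        else (col(u := 0), None, R 21))) \<and>
      t' \<le> t + 30 * length as + 20) (R, xs, t)"
proof (cases b)
  case False
  note [simp] = envD[OF e] u x
  show ?thesis using False c b
    by (simp add: wp_When represents_def drop_forced_def)
next
  case True
  note [simp] = envD[OF e] u x
  let ?R = "R(15 := 0)"
  have sub: "agree {13..25} R ?R" by simp
  have e': "env n k P as ?R" by (rule agree_env[OF sub e]) auto
  have run: "wp expand_code (\<lambda>(R', xs', t'). xs' = xs \<and> agree {13, 14, 15, 16, 18, 20, 23, 24, 25} ?R R' \<and>
    coloured n R' (expand E col u) \<and>
    R' 20 = int ((if first then 5 else 0) + card (fresh E col u)) \<and>
    (fresh E col u \<noteq> {} \<longrightarrow> (\<exists>w\<in>fresh E col u. R' 18 = int w)) \<and>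
    t' \<le> t + 2 + 30 * length as + 6) (?R, xs, t + 2)"
    by (rule expand_code[OF e' _ _ _ as E]) (use c in auto)
  have "wp expand_code (wp (Unless 22 (Ins (Add 14 4 17) ;; Ins (Store 14 1)) ;;
     Ins (Const 19 0) ;; Ins (Sub 15 20 0) ;;
     Unless 15 (Ins (Sub 15 0 20) ;; Unless 15 (Ins (Const 19 1))) ;; Ins (Const 20 0))
    (\<lambda>(R', xs', t'). xs' = xs \<and> agree {13..25} R R' \<and>
      represents n R' False (drop_forced first (expand E col u, forced E col u, R 21)) \<and>
      t' \<le> t + 30 * length as + 20)) (?R, xs, t + 2)"
  proof (rule wp_conseq[OF run], clarify, goal_cases)
    case (1 R1 xs1 t1)
    then have a: "agree {13..25} R R1" by (intro agree_trans[OF sub 1(1)]) auto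
    have e1: "env n k P as R1" by (rule agree_env[OF a e]) auto
    have r: "R1 22 = 1" "R1 17 = int u" "R1 21 = R 21"
      using agreeD[OF 1(1), of 22] agreeD[OF 1(1), of 17] agreeD[OF 1(1), of 21] b True by auto
    note [simp] = envD[OF e1] r
    consider "card (fresh E col u) = 1" "\<not> first" | "card (fresh E col u) \<noteq> 1 \<or> first" by blast
    then show ?case
    proof cases
      case 2
      \<comment> \<open>In the first move register 20 starts at 5, so it cannot end at 1.\<close>
      then have "R1 20 = 0 \<or> R1 20 > 1" using 1(3) by (auto split: if_splits)
      moreover have "first \<or> forced E col u = None" using 2 by (auto simp: forced_def)
      ultimately show ?thesis using 1(2,5) a
        by (auto simp: represents_def drop_forced_def branch_def)
    next
      case c: 1
      then obtain w where w: "fresh E col u = {w}" by (auto simp: card_1_singleton_iff)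
      then have "R1 18 = int w" "forced E col u = Some w" using 1(4) by (auto simp: forced_def)
      then show ?thesis using 1(2,3,5) a c
        by (auto simp: represents_def drop_forced_def branch_def)
    qed
  qed
  then show ?thesis using True b by (simp add: wp_When)
qed

lemma decide:
  assumes e: "env n k P as R" and c: "coloured n R col"
  shows "wp decide (\<lambda>(R', xs', t'). xs' = xs \<and> agree {13, 14, 15, 16, 17, 21, 22} R R' \<and>
    coloured n R' col \<and> R' 17 = int (pick n col) \<and>
    R' 22 = (if P \<le> 2 * R 21 then 1 else 0) \<and>
    R' 21 = (if P \<le> 2 * R 21 then 2 * R 21 - P else 2 * R 21) \<and> t' \<le> t + 10 * n + 20) (R, xs, t)"
  unfolding decide_def wp.simps(2)
proof (rule wp_conseq[OF scan[OF e c]], clarify, goal_cases)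
  case (1 R1 xs1 t1)
  have a: "agree {13, 14, 15, 16, 17, 21, 22} R R1" by (rule agree_trans[OF agree_refl 1(1)]) auto
  have e1: "env n k P as R1" by (rule agree_env[OF a e]) auto
  have r: "R1 21 = R 21" using agreeD[OF 1(1), of 21] by simp
  note [simp] = envD[OF e1] r
  show ?case using 1(2-4) a by (auto simp: wp_When)
qed


lemma move_code:
  assumes e: "env n k P as R" and rep: "represents n R first st"
    and f: "first \<Longrightarrow> fst (snd st) \<noteq> None"
    and as: "\<forall>a b. (a, b) \<in> set as \<longleftrightarrow> {a, b} \<in> E"
    and E: "\<forall>a b. {a, b} \<in> E \<longrightarrow> a < n \<and> b < n \<and> a \<noteq> b"
  shows "wp move_code (\<lambda>(R', xs', t'). xs' = xs \<and> agree {13..25} R R' \<and>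
    represents n R' False (drop_forced first (move n E P st)) \<and>
    t' \<le> t + 10 * n + 30 * length as + 50) (R, xs, t)"
proof -
  obtain col f q where st: "st = (col, f, q)" by (rule prod_cases3)
  have c: "coloured n R col" and f19: "R 19 = (if f = None then 0 else 1)"
    and f18: "\<And>w. f = Some w \<Longrightarrow> R 18 = int w" and q: "R 21 = q"
    and x: "R 20 = (if first then 5 else 0)"
    using rep by (auto simp: represents_def st)
  let ?tail = "When 22 expand_code ;; Unless 22 (Ins (Add 14 4 17) ;; Ins (Store 14 1)) ;;
     Ins (Const 19 0) ;; Ins (Sub 15 20 0) ;;
     Unless 15 (Ins (Sub 15 0 20) ;; Unless 15 (Ins (Const 19 1))) ;; Ins (Const 20 0)"
  let ?Q = "\<lambda>(R', xs', t'). xs' = xs \<and> agree {13..25} R R' \<and>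
    represents n R' False (drop_forced first (move n E P st)) \<and>
    t' \<le> t + 10 * n + 30 * length as + 50"
  note [simp] = envD[OF e]
  show ?thesis
  proof (cases f)
    case (Some w)
    let ?R = "R(15 := 0, 17 := int w, 22 := 1)"
    have a: "agree {13..25} R ?R" by simp
    have e': "env n k P as ?R" by (rule agree_env[OF a e]) auto
    have "wp ?tail (\<lambda>(R', xs', t'). xs' = xs \<and> agree {13..25} ?R R' \<and>
      represents n R' False (drop_forced first (if True then (expand E col w, forced E col w, ?R 21)
        else (col(w := 0), None, ?R 21))) \<and>
      t' \<le> t + 5 + 30 * length as + 20) (?R, xs, t + 5)"
      by (rule move_tail[OF e' _ _ _ _ as E]) (use c x in auto)
    then have "wp ?tail ?Q (?R, xs, t + 5)"
      by (rule wp_conseq) (use agree_trans[OF a] Some st q in auto)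
    then show ?thesis using Some f19 f18
      by (simp add: move_code_def wp_When wp_Unless eval_nat_numeral del: wp.simps(3))
  next
    case None
    then have nf: "\<not> first" using f st by auto
    let ?R = "R(15 := 1)"
    have a: "agree {13..25} R ?R" by simp
    have e': "env n k P as ?R" by (rule agree_env[OF a e]) auto
    have "wp decide (wp ?tail ?Q) (?R, xs, t + 3)"
    proof (rule wp_conseq[OF decide[OF e', of col]], use c in simp, clarify, goal_cases)
      case (1 R1 xs1 t1)
      have a1: "agree {13..25} R R1" by (rule agree_trans[OF a 1(1)]) auto
      have e1: "env n k P as R1" by (rule agree_env[OF a1 e]) auto
      have x1: "R1 20 = (if first then 5 else 0)" using agreeD[OF 1(1), of 20] x by simp
      have q1: "R1 22 = (if P \<le> 2 * q then 1 else 0)"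
        "R1 21 = (if P \<le> 2 * q then 2 * q - P else 2 * q)" using 1(4,5) q by simp_all
      show ?case
        by (rule wp_conseq[OF move_tail[OF e1 1(2,3) x1 q1(1) as E]])
          (use agree_trans[OF a1] 1(6) None st q1 nf in \<open>auto split: if_splits\<close>)
    qed
    then show ?thesis using None f19
      by (simp add: move_code_def wp_When wp_Unless numeral_3_eq_3 del: wp.simps(3))
  qed
qed

lemma clear:
  assumes e: "env n k P as R"
  shows "wp clear (\<lambda>(R', xs', t'). xs' = xs \<and> agree {13, 14, 15} R R' \<and> coloured n R' (\<lambda>_. -2) \<and>
    t' \<le> t + 10 * n + 4) (R, xs, t)"
proof -
  define Inv where "Inv i R' xs' t' \<longleftrightarrow> xs' = xs \<and> agree {13, 14, 15} R R' \<and>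
    (\<forall>v<n. i \<le> v \<longrightarrow> R' (100 + int v) = -2) \<and> t' + 10 * i \<le> t + 10 * n + 4" for i R' xs' t'
  note [simp] = envD[OF e]
  show ?thesis
  proof (simp add: clear_def, rule wp_For[where Inv = Inv and N = n], goal_cases)
    case 4
    then show ?case by (auto simp: Inv_def)
  next
    case i: (5 i R1 xs1 t1)
    then have a: "agree {13, 14, 15} R R1" by (simp add: Inv_def)
    have e1: "env n k P as R1" by (rule agree_env[OF a e]) auto
    note [simp] = envD[OF e1]
    show ?case using i by (auto simp: Inv_def Suc_le_eq)
  next
    case (6 R1 xs1 t1)
    then show ?case by (auto simp: Inv_def coloured_def)
  qed simp_all
qed

lemma tally:
  assumes e: "env n k P as R" and c: "coloured n R col"
  shows "wp tally (\<lambda>(R', xs', t'). xs' = xs \<and> agree {9, 13, 14, 15, 16, 22} R R' \<and>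
    R' 9 = (if won n (nat k) col then 1 else R 9) \<and> t' \<le> t + 20 * n + 20) (R, xs, t)"
proof -
  let ?X = "{9, 13, 14, 15, 16, 22} :: int set"
  define S where "S i = {v. i \<le> v \<and> v < n \<and> 0 \<le> col v}" for i
  define Inv where "Inv i R' xs' t' \<longleftrightarrow> xs' = xs \<and> agree ?X R R' \<and> coloured n R' col \<and> R' 9 = R 9 \<and>
    R' 22 = int (card (S i)) \<and> t' + 20 * i \<le> t + 20 * n + 4" for i R' xs' t'
  have fin: "finite (S i)" for i by (rule finite_subset[of _ "{..<n}"]) (auto simp: S_def)
  have S: "S i = (if 0 \<le> col i then insert i (S (Suc i)) else S (Suc i))" if "i < n" for i
    using that by (auto simp: S_def le_Suc_eq Suc_le_eq le_less)
  have Sn: "i \<notin> S (Suc i)" for i by (simp add: S_def)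
  have Sn0: "S n = {}" by (auto simp: S_def)
  note [simp] = envD[OF e]
  show ?thesis
  proof (simp add: tally_def split del: if_split, rule wp_For[where Inv = Inv and N = n], goal_cases)
    case 4
    then show ?case using c by (auto simp: Inv_def Sn0)
  next
    case i: (5 i R1 xs1 t1)
    then have a: "agree ?X R R1" and c1: "coloured n R1 col" by (simp_all add: Inv_def)
    have e1: "env n k P as R1" by (rule agree_env[OF a e]) auto
    note [simp] = envD[OF e1]
    have "R1 (100 + int i) = col i" using colouredD[OF c1 i(1)] by simp
    then show ?case using i(2,3) by (auto simp: Inv_def wp_When S[OF i(1)] Sn fin)
  next
    case (6 R1 xs1 t1)
    then have a: "agree ?X R R1" by (simp add: Inv_def)
    have e1: "env n k P as R1" by (rule agree_env[OF a e]) auto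
    note [simp] = envD[OF e1]
    have "S 0 = {v. v < n \<and> 0 \<le> col v}" by (simp add: S_def)
    then have "won n (nat k) col \<longleftrightarrow> k \<le> int (card (S 0))" by (simp add: won_def nat_le_iff)
    then show ?case using 6 by (auto simp: Inv_def wp_When)
  qed simp_all
qed


definition simulate_time :: "nat \<Rightarrow> nat \<Rightarrow> nat" where
  "simulate_time n m = n * (10 * n + 30 * m + 60) + 30 * n + 60"

lemma simulate:
  assumes e: "env n k P as R" and r: "R 10 = int r" "r < n" and q: "R 11 = q"
    and as: "\<forall>a b. (a, b) \<in> set as \<longleftrightarrow> {a, b} \<in> E"
    and E: "\<forall>a b. {a, b} \<in> E \<longrightarrow> a < n \<and> b < n \<and> a \<noteq> b"
  shows "wp simulate (\<lambda>(R', xs', t'). xs' = xs \<and> agree (insert 9 {12..25}) R R' \<and>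
    R' 9 = (if won n (nat k) (run n E P r q) then 1 else R 9) \<and>
    t' \<le> t + simulate_time n (length as)) (R, xs, t)"
proof -
  \<comment> \<open>The state before move \<open>j\<close>. The root's expansion is move 0, carried
    out as a forced move, so the machine makes \<open>n\<close> moves for the \<open>n - 1\<close>
    of \<open>run\<close>.\<close>
  define st where "st j = (if j = 0 then (\<lambda>_. -2, Some r, q)
    else (move n E P ^^ (j - 1)) (expand E (\<lambda>_. -2) r, None, q))" for j
  have st_Suc: "st (Suc j) = drop_forced (j = 0) (move n E P (st j))" for j
    by (cases j) (auto simp: st_def drop_forced_def)
  have st_n: "fst (st n) = run n E P r q" using r(2) by (simp add: st_def run_def)
  define B where "B = 10 * n + 30 * length as + 60"
  define Inv where "Inv i R' xs' t' \<longleftrightarrow> xs' = xs \<and> agree {12..25} R R' \<and> i \<le> n \<and>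
    represents n R' (n - i = 0) (st (n - i)) \<and> t' + i * B \<le> t + n * B + 10 * n + 20" for i R' xs' t'
  show ?thesis
    unfolding simulate_def wp.simps(2)
  proof (rule wp_conseq[OF clear[OF e]], clarify, goal_cases)
    case (1 R1 xs1 t1)
    have a1: "agree {12..25} R R1" by (rule agree_trans[OF agree_refl 1(1)]) auto
    have e1: "env n k P as R1" by (rule agree_env[OF a1 e]) auto
    have r1: "R1 10 = int r" "R1 11 = q" using agreeD[OF 1(1)] r(1) q by simp_all
    note [simp] = envD[OF e1] r1
    show ?case
    proof (simp split del: if_split, rule wp_For[where Inv = Inv and N = n], goal_cases)
      case 4
      show ?case using a1 1(2,3) by (simp add: Inv_def represents_def st_def)
    next
      case i: (5 i R2 xs2 t2)
      then have inv: "xs2 = xs" "agree {12..25} R R2"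
        "represents n R2 (n - Suc i = 0) (st (n - Suc i))" "t2 + Suc i * B \<le> t + n * B + 10 * n + 20"
        by (simp_all add: Inv_def)
      let ?R = "R2(12 := int i)"
      have a: "agree {12..25} R ?R" using inv(2) by simp
      have e2: "env n k P as ?R" by (rule agree_env[OF a e]) auto
      have rep: "represents n ?R (n - Suc i = 0) (st (n - Suc i))"
        using inv(3) by (simp add: represents_def case_prod_unfold)
      have ni: "n - i = Suc (n - Suc i)" using i(1) by simp
      have "wp move_code (\<lambda>(R', xs', t'). R' 12 = int i \<and> Inv i R' xs' (Suc t')) (?R, xs2, Suc t2)"
      proof (rule wp_conseq[OF move_code[OF e2 rep _ as E]], goal_cases)
        case 1
        then show ?case by (simp add: st_def)
      next
        case (2 R3 xs3 t3)
        have "agree {12..25} R R3" using 2 by (intro agree_trans[OF a, of "{13..25}"]) auto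
        moreover have "R3 12 = int i" using 2 agreeD[of "{13..25}" ?R R3 12] by simp
        ultimately show ?case using 2 inv(1,4) i(1)
          by (simp add: Inv_def ni st_Suc B_def)
      qed
      moreover have "R2 0 = 1" using envD(1)[OF e2] by simp
      ultimately show ?case by simp
    next
      case (6 R2 xs2 t2)
      then have inv: "xs2 = xs" "agree {12..25} R R2" "represents n R2 False (st n)"
        "t2 \<le> t + n * B + 10 * n + 20" using r(2) by (simp_all add: Inv_def)
      have e2: "env n k P as R2" by (rule agree_env[OF inv(2) e]) auto
      have c: "coloured n R2 (run n E P r q)"
        using inv(3) st_n by (auto simp: represents_def)
      have a: "agree (insert 9 {12..25}) R R2" by (rule agree_trans[OF agree_refl inv(2)]) auto
      have "R2 9 = R 9" using agreeD[OF inv(2), of 9] by simp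
      then show ?case
        by (intro wp_conseq[OF tally[OF e2 c]])
          (use agree_trans[OF a] inv(1,4) in \<open>auto simp: simulate_time_def B_def\<close>)
    qed simp_all
  qed
qed

definition search_time :: "nat \<Rightarrow> nat \<Rightarrow> nat \<Rightarrow> nat" where
  "search_time n m N = n * (N * (simulate_time n m + 5) + 10) + 10"

lemma search:
  assumes e: "env n k (int N) as R" and R9: "R 9 = 0"
    and as: "\<forall>a b. (a, b) \<in> set as \<longleftrightarrow> {a, b} \<in> E"
    and E: "\<forall>a b. {a, b} \<in> E \<longrightarrow> a < n \<and> b < n \<and> a \<noteq> b"
  shows "wp search (\<lambda>(R', xs', t'). xs' = xs \<and> env n k (int N) as R' \<and>
    R' 9 = (if \<exists>r<n. \<exists>q. 0 \<le> q \<and> q < int N \<and> won n (nat k) (run n E (int N) r q) then 1 else 0) \<and>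
    t' \<le> t + search_time n (length as) N) (R, xs, t)"
proof -
  define W where "W r q \<longleftrightarrow> won n (nat k) (run n E (int N) r q)" for r q
  define B where "B = simulate_time n (length as) + 5"
  \<comment> \<open>Both loops count down: at index \<open>i\<close>, register 9 covers the roots
    from \<open>i\<close> on, and \<open>In\<close> below does the same for the values of
    \<open>q\<close>.\<close>
  define Out where "Out i R' xs' t' \<longleftrightarrow> xs' = xs \<and> agree {9..25} R R' \<and>
    R' 9 = (if \<exists>r q. i \<le> r \<and> r < n \<and> q < N \<and> W r (int q) then 1 else 0) \<and>
    t' + i * (N * B + 10) \<le> t + n * (N * B + 10) + 4" for i R' xs' t'
  note [simp] = envD[OF e]
  have W: "(\<exists>r<n. \<exists>q. 0 \<le> q \<and> q < int N \<and> W r q) \<longleftrightarrow> (\<exists>r q. 0 \<le> r \<and> r < n \<and> q < N \<and> W r (int q))"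
    by (metis le0 nat_less_iff of_nat_0_le_iff of_nat_less_iff int_nat_eq)
  show ?thesis
    unfolding W_def[symmetric] W
  proof (simp add: search_def split del: if_split, rule wp_For[where Inv = Out and N = n], goal_cases)
    case 4
    show ?case by (simp add: Out_def R9)
  next
    case i: (5 r R1 xs1 t1)
    then have out: "xs1 = xs" "agree {9..25} R R1"
      "R1 9 = (if \<exists>r' q. Suc r \<le> r' \<and> r' < n \<and> q < N \<and> W r' (int q) then 1 else 0)"
      "t1 + Suc r * (N * B + 10) \<le> t + n * (N * B + 10) + 4" by (simp_all add: Out_def)
    have e1: "env n k (int N) as R1" by (rule agree_env[OF out(2) e]) auto
    define In where "In i R' xs' t' \<longleftrightarrow> xs' = xs \<and> agree {9..25} R R' \<and> R' 10 = int r \<and>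
      R' 9 = (if \<exists>q. i \<le> q \<and> q < N \<and> W r (int q) then 1 else R1 9) \<and>
      t' + i * B \<le> t1 + N * B + 5" for i R' xs' t'
    note [simp] = envD[OF e1]
    have "wp (Ins (Add 11 8 1) ;; For 11 simulate) (\<lambda>(R', xs', t'). R' 10 = int r \<and> Out r R' xs' (Suc t'))
      (R1(10 := int r), xs1, Suc t1)"
    proof (simp split del: if_split, rule wp_For[where Inv = In and N = N], goal_cases)
      case 4
      show ?case using out(1,2) by (auto simp: In_def)
    next
      case j: (5 q R2 xs2 t2)
      then have inn: "xs2 = xs" "agree {9..25} R R2" "R2 10 = int r"
        "R2 9 = (if \<exists>q'. Suc q \<le> q' \<and> q' < N \<and> W r (int q') then 1 else R1 9)"
        "t2 + Suc q * B \<le> t1 + N * B + 5" by (simp_all add: In_def)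
      let ?R = "R2(11 := int q)"
      have a: "agree {9..25} R ?R" using inn(2) by simp
      have e2: "env n k (int N) as ?R" by (rule agree_env[OF a e]) auto
      have ex: "(\<exists>q'. q \<le> q' \<and> q' < N \<and> W r (int q')) \<longleftrightarrow>
          W r (int q) \<or> (\<exists>q'. Suc q \<le> q' \<and> q' < N \<and> W r (int q'))"
        using j(1) by (metis Suc_le_eq le_eq_less_or_eq)
      have "wp simulate (\<lambda>(R', xs', t'). R' 11 = int q \<and> In q R' xs' (Suc t')) (?R, xs2, Suc t2)"
      proof (rule wp_conseq[OF simulate[OF e2 _ i(1) _ as E, of "int q"]], goal_cases)
        case (3 R3 xs3 t3)
        have "agree {9..25} R R3" using 3 by (intro agree_trans[OF a, of "insert 9 {12..25}"]) auto
        moreover have "R3 11 = int q" "R3 10 = int r"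
          using 3 inn(3) agreeD[of "insert 9 {12..25}" ?R R3] by simp_all
        ultimately show ?case using 3 inn(1,4,5)
          by (auto simp: In_def ex W_def[symmetric] B_def)
      qed (use inn(3) in simp_all)
      moreover have "R2 0 = 1" using envD(1)[OF e2] by simp
      ultimately show ?case by simp
    next
      case (6 R2 xs2 t2)
      have ex: "(\<exists>r' q. r \<le> r' \<and> r' < n \<and> q < N \<and> W r' (int q)) \<longleftrightarrow>
          (\<exists>q<N. W r (int q)) \<or> (\<exists>r' q. Suc r \<le> r' \<and> r' < n \<and> q < N \<and> W r' (int q))"
        using i(1) by (metis Suc_le_eq le_eq_less_or_eq)
      have R2: "R2 9 = (if \<exists>q. 0 \<le> q \<and> q < N \<and> W r (int q) then 1 else R1 9)"
        using 6 by (simp only: In_def)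
      have "R2 9 = (if \<exists>r' q. r \<le> r' \<and> r' < n \<and> q < N \<and> W r' (int q) then 1 else 0)"
        unfolding R2 ex out(3) by auto
      then show ?case using 6 out(4) by (simp add: In_def Out_def)
    qed simp_all
    then show ?case by simp
  next
    case (6 R1 xs1 t1)
    then have "agree {9..25} R R1" by (simp add: Out_def)
    then have "env n k (int N) as R1" by (rule agree_env[OF _ e]) auto
    then show ?case using 6 by (simp add: Out_def search_time_def B_def)
  qed simp_all
qed


lemma small_case:
  assumes e: "env n k P as R" and n: "n > 0"
  shows "wp small_case (\<lambda>(R', xs', t'). R' 9 = (if n = 2 \<and> k \<le> 2 then 1 else R 9) \<and>
    t' \<le> t + 20) (R, xs, t)"
proof -
  note [simp] = envD[OF e]
  show ?thesis using n by (auto simp: small_case_def wp_When)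
qed

section \<open>Reading the input and assembling the program\<close>

definition arcs_of :: "(nat \<times> nat) list \<Rightarrow> (nat \<times> nat) list" where
  "arcs_of es = concat (map (\<lambda>(u, v). [(u, v), (v, u)]) es)"

lemma length_arcs_of [simp]: "length (arcs_of es) = 2 * length es"
  by (induction es) (auto simp: arcs_of_def)

lemma set_arcs_of: "(a, b) \<in> set (arcs_of es) \<longleftrightarrow> {a, b} \<in> (\<lambda>(u, v). {u, v}) ` set es"
  by (induction es) (auto simp: arcs_of_def doubleton_eq_iff)

lemma arcs_at_append:
  assumes "arcs_at as R" "\<And>i. - (2 * int (length as)) \<le> i \<Longrightarrow> i < 0 \<Longrightarrow> R' i = R i"
    "R' (- 1 - 2 * int (length as)) = int a" "R' (- 2 - 2 * int (length as)) = int b"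
    "R' (- 3 - 2 * int (length as)) = int b" "R' (- 4 - 2 * int (length as)) = int a"
  shows "arcs_at (as @ [(a, b), (b, a)]) R'"
  unfolding arcs_at_def
proof (intro allI impI)
  fix j assume j: "j < length (as @ [(a, b), (b, a)])"
  let ?P = "\<lambda>j. R' (- (2 * int j + 1)) = int (fst ((as @ [(a, b), (b, a)]) ! j)) \<and>
    R' (- (2 * int j + 2)) = int (snd ((as @ [(a, b), (b, a)]) ! j))"
  consider "j < length as" | "j = length as" | "j = Suc (length as)" using j by auto linarith
  then show "?P j"
  proof cases
    case 1
    then have "R' (- (2 * int j + 1)) = R (- (2 * int j + 1))"
      "R' (- (2 * int j + 2)) = R (- (2 * int j + 2))" by (intro assms(2); linarith)+
    with 1 assms(1) show ?thesis by (simp add: arcs_at_def nth_append)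
  qed (use assms(3-6) in \<open>simp_all add: nth_append algebra_simps\<close>)
qed

lemma initialise:
  fixes es :: "(nat \<times> nat) list"
  assumes xs: "xs = int n # int (length es) # k # concat (map (\<lambda>(u, v). [int u, int v]) es)"
  shows "wp initialise (\<lambda>(R, xs, t). env n k (int (2 ^ (2 * nat k))) (arcs_of es) R \<and> R 9 = 0 \<and>
    t \<le> 30 * length es + 20 * nat k + 50) ((\<lambda>_. 0), xs, 0)"
proof -
  let ?m = "length es"
  let ?in = "\<lambda>es. concat (map (\<lambda>(u, v). [int u, int v]) es)"
  define const where "const R \<longleftrightarrow> R 0 = (1::int) \<and> R 1 = 0 \<and> R 2 = -1 \<and> R 3 = -2 \<and> R 4 = 100 \<and>
    R 5 = int n \<and> R 7 = k \<and> R 9 = 0" for R :: "int \<Rightarrow> int"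
  \<comment> \<open>An edge occupies four registers, two for each of its arcs, hence the pointer
    value in register 23.\<close>
  define Inv where "Inv i R xs t \<longleftrightarrow> const R \<and> R 6 = int ?m \<and> i \<le> ?m \<and>
    arcs_at (arcs_of (take (?m - i) es)) R \<and> xs = ?in (drop (?m - i) es) \<and>
    R 23 = - (4 * int (?m - i) + 1) \<and> t + 30 * i \<le> 30 * ?m + 12" for i R xs and t :: nat
  show ?thesis
  proof (simp add: initialise_def xs, rule wp_For[where Inv = Inv and N = ?m], goal_cases)
    case 4
    show ?case by (simp add: Inv_def const_def arcs_at_def arcs_of_def)
  next
    case i: (5 i R1 xs1 t1)
    define j where "j = ?m - Suc i"
    obtain a b where ab: "es ! j = (a, b)" by (cases "es ! j")
    have j: "j < ?m" "?m - i = Suc j" using i(1) by (auto simp: j_def)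
    have inv: "const R1" "R1 6 = int ?m" "arcs_at (arcs_of (take j es)) R1"
      "xs1 = ?in (drop j es)" "R1 23 = - (4 * int j + 1)" "t1 + 30 * Suc i \<le> 30 * ?m + 12"
      using i(3) by (auto simp: Inv_def j_def)
    have xs1: "xs1 = int a # int b # ?in (drop (Suc j) es)"
      using inv(4) Cons_nth_drop_Suc[OF j(1), symmetric] ab by simp
    have as: "arcs_of (take (Suc j) es) = arcs_of (take j es) @ [(a, b), (b, a)]"
      using j(1) ab by (simp add: arcs_of_def take_Suc_conv_app_nth)
    have [simp]: "min ?m j = j" using j(1) by simp
    have c: "R1 0 = 1" "R1 1 = 0" "R1 2 = -1" "R1 3 = -2" "R1 4 = 100" "R1 5 = int n" "R1 7 = k" "R1 9 = 0"
      using inv(1) by (simp_all add: const_def)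
    show ?case using i(1,2) inv(2,5,6) c unfolding xs1
      by (simp add: Inv_def j(2) as const_def)
        (rule arcs_at_append[OF inv(3)]; simp)
  next
    case (6 R1 xs1 t1)
    \<comment> \<open>The number of doublings; for negative \<open>k\<close> it is 0, so it equals
      \<open>2 * nat k\<close> in all cases.\<close>
    define K where "K = nat (k + k)"
    have inv: "const R1" "R1 6 = int ?m" "arcs_at (arcs_of es) R1" "t1 \<le> 30 * ?m + 12"
      using 6 by (auto simp: Inv_def)
    have c: "R1 0 = 1" "R1 1 = 0" "R1 2 = -1" "R1 3 = -2" "R1 4 = 100" "R1 5 = int n" "R1 7 = k" "R1 9 = 0"
      using inv(1) by (simp_all add: const_def)
    define Inv' where "Inv' i R xs t \<longleftrightarrow> env n k (2 ^ (K - i)) (arcs_of es) R \<and> R 9 = 0 \<and>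
      i \<le> K \<and> t + 10 * i \<le> 30 * ?m + 10 * K + 30" for i R and xs :: "int list" and t :: nat
    have K: "K = 2 * nat k" by (simp add: K_def nat_add_distrib[symmetric])
    show ?case
    proof (simp add: c, rule wp_For[where Inv = Inv' and N = K], goal_cases)
      case 4
      show ?case using inv c by (simp add: Inv'_def env_def arcs_at_def)
    next
      case i: (5 i R2 xs2 t2)
      then have "K - i = Suc (K - Suc i)" by simp
      then show ?case using i by (simp add: Inv'_def env_def arcs_at_def)
    next
      case (6 R2 xs2 t2)
      then show ?case by (simp add: Inv'_def K)
    qed (simp_all add: c K_def)
  qed simp_all
qed

lemma body:
  assumes n: "n > 0" and xs: "xs = int n # int (length es) # k # concat (map (\<lambda>(u, v). [int u, int v]) es)"
    and as: "\<forall>a b. (a, b) \<in> set (arcs_of es) \<longleftrightarrow> {a, b} \<in> E"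
    and E: "\<forall>a b. {a, b} \<in> E \<longrightarrow> a < n \<and> b < n \<and> a \<noteq> b"
  shows "wp body (\<lambda>(R, xs, t). R 9 = (if n = 2 \<and> k \<le> 2 \<or>
      (\<exists>r<n. \<exists>q. 0 \<le> q \<and> q < 2 ^ (2 * nat k) \<and> won n (nat k) (run n E (2 ^ (2 * nat k)) r q)) then 1 else 0) \<and>
    t \<le> 30 * length es + 20 * nat k + 70 + search_time n (2 * length es) (2 ^ (2 * nat k)))
    ((\<lambda>_. 0), xs, 0)"
  unfolding body_def wp.simps(2)
proof (rule wp_conseq[OF initialise[OF xs]], clarify, goal_cases)
  case (1 R1 xs1 t1)
  show ?case
  proof (rule wp_conseq[OF search[OF 1(1,2) as E]], clarify, goal_cases)
    case (1 R2 xs2 t2)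
    show ?case
      by (rule wp_conseq[OF small_case[OF 1(1) n]]) (use 1(2,3) \<open>t1 \<le> _\<close> in auto)
  qed
qed

section \<open>The overall time bound\<close>

lemma search_time_le:
  assumes n: "n \<le> 2 * m + 1" and N: "N > 0"
  shows "search_time n (2 * m) N \<le> 900 * N * (m + 1) ^ 3"
proof -
  \<comment> \<open>As \<open>x\<close> is at least 1, all lower-order terms are absorbed into its
    highest power.\<close>
  define x where "x = m + 1"
  have x: "1 \<le> x" "n \<le> 2 * x" "2 * m \<le> 2 * x" using n by (simp_all add: x_def)
  have x2: "x \<le> x * x" "1 \<le> x * x" using x by simp_all
  have x3: "x * x \<le> x * x * x" "1 \<le> x * x * x" using x by simp_all
  have "n * (10 * n + 30 * (2 * m) + 60) \<le> 2 * x * (10 * (2 * x) + 30 * (2 * x) + 60 * x)"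
    using x by (intro mult_mono add_mono) auto
  also have "\<dots> = 280 * (x * x)" by (simp add: algebra_simps)
  finally have "simulate_time n (2 * m) \<le> 280 * (x * x) + 30 * n + 60"
    unfolding simulate_time_def by simp
  moreover have "30 * n + 60 \<le> 120 * (x * x)" using x x2 by linarith
  ultimately have "simulate_time n (2 * m) \<le> 400 * (x * x)" by linarith
  then have "simulate_time n (2 * m) + 5 \<le> 405 * (x * x)" using x2 by linarith
  then have "N * (simulate_time n (2 * m) + 5) + 10 \<le> N * (405 * (x * x)) + 10 * (N * (x * x))"
    using N x2 by (intro add_mono mult_le_mono2) (auto simp: Suc_le_eq)
  then have "n * (N * (simulate_time n (2 * m) + 5) + 10) \<le> 2 * x * (415 * (N * (x * x)))"
    using x by (intro mult_le_mono) (auto simp: algebra_simps)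
  moreover have "10 \<le> 10 * (N * (x * x * x))" using N x3 by (simp add: Suc_le_eq)
  ultimately have "search_time n (2 * m) N \<le> 2 * x * (415 * (N * (x * x))) + 10 * (N * (x * x * x))"
    unfolding search_time_def by linarith
  also have "\<dots> = 840 * (N * (x * x * x))" by (simp add: algebra_simps)
  also have "\<dots> \<le> 900 * N * x ^ 3" by (simp add: power3_eq_cube algebra_simps)
  finally show ?thesis by (simp add: x_def)
qed

text \<open>The two extra steps are the final jump on register 9 and the
  \<open>Halt\<close>.\<close>

lemma program_answers:
  assumes "wp body (\<lambda>(R, xs, t). R 9 = (if b then 1 else 0) \<and> t \<le> B) ((\<lambda>_. 0), xs, 0)"
  shows "\<exists>t. answers_in_time program xs b t \<and> t \<le> B + 2"
proof -
  have len: "length program = code_length body + 3" by (simp add: program_def)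
  have "code_at program 0 (compile body 0)" by (auto simp: code_at_def program_def)
  from wp_compile[OF assms this] obtain s R' xs' where
    s: "steps program s (0, (\<lambda>_. 0), xs) = Some (code_length body, R', xs')"
      "R' 9 = (if b then 1 else 0)" "s \<le> B" by auto
  have at: "program ! code_length body = JumpPos 9 (code_length body + 2)"
    "program ! (code_length body + 1) = Halt False" "program ! (code_length body + 2) = Halt True"
    by (simp_all add: program_def nth_append)
  let ?pc = "if b then code_length body + 2 else code_length body + 1"
  have "halts_with program (?pc, R', xs') b 1"
    using at len by (intro halts_with.halt) auto
  then have "halts_with program (code_length body, R', xs') b (Suc 1)"
    using at(1) len s(2) by (intro halts_with.step) auto
  from halts_with_steps[OF s(1) this] s(3) show ?thesis
    by (intro exI[of _ "s + Suc 1"]) (simp add: answers_in_time_def)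
qed

lemma program_correct:
  assumes G: "simple_graph V E" "connected_graph V E" and enc: "encodes_instance xs V E k"
  shows "\<exists>t. answers_in_time program xs (max_leaves_spanning_tree V E k) t \<and>
    t \<le> 1100 * 4 ^ nat k * (card E + 1) ^ 3"
proof -
  define n where "n = card V"
  from enc obtain es where V: "V = {..<n}" and Ees: "E = (\<lambda>(u, v). {u, v}) ` set es"
    and len: "length es = card E"
    and xs: "xs = int n # int (length es) # k # concat (map (\<lambda>(u, v). [int u, int v]) es)"
    unfolding encodes_instance_def n_def by auto
  interpret numbered_graph n E by unfold_locales (use G V in simp)
  have n: "n > 0" using G V by (auto simp: simple_graph_def)
  have as: "\<forall>a b. (a, b) \<in> set (arcs_of es) \<longleftrightarrow> {a, b} \<in> E" by (simp add: set_arcs_of Ees)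
  have E: "\<forall>a b. {a, b} \<in> E \<longrightarrow> a < n \<and> b < n \<and> a \<noteq> b" using edge by blast
  have ans: "max_leaves_spanning_tree V E k \<longleftrightarrow> n = 2 \<and> k \<le> 2 \<or>
      (\<exists>r<n. \<exists>q. 0 \<le> q \<and> q < 2 ^ (2 * nat k) \<and> won n (nat k) (run n E (2 ^ (2 * nat k)) r q))"
    unfolding max_leaves_iff[OF G] run_correct by (simp add: V nat_le_iff)
  let ?m = "card E" and ?N = "2 ^ (2 * nat k) :: nat"
  have N: "?N = 4 ^ nat k" by (simp add: power_mult)
  have "n \<le> 2 * ?m + 1" using card_le_edges[OF G] by (simp add: n_def)
  then have st: "search_time n (2 * ?m) ?N \<le> 900 * ?N * (?m + 1) ^ 3"
    by (rule search_time_le) simp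
  have x: "?m + 1 \<le> (?m + 1) ^ 3" by (rule self_le_power) simp_all
  have k: "nat k \<le> ?N" using less_exp[of "2 * nat k"] by linarith
  \<comment> \<open>The terms \<open>?m\<close>, \<open>nat k\<close> and 1 are each at most
    \<open>?N * (?m + 1) ^ 3\<close>, and 30 + 20 + 72 = 122; with the 900 for the search the sum
    stays below 1100.\<close>
  have "30 * ?m + 20 * nat k + 72 \<le> 122 * (?N * (?m + 1) ^ 3)"
  proof -
    have "?m + 1 \<le> ?N * (?m + 1) ^ 3" using x le_trans[OF x, of "?N * (?m + 1) ^ 3"] by simp
    moreover have "?N * 1 \<le> ?N * (?m + 1) ^ 3" by (intro mult_le_mono2) simp
    ultimately show ?thesis using k by linarith
  qed
  with st have le: "30 * length es + 20 * nat k + 70 + search_time n (2 * length es) ?N + 2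
      \<le> 1100 * ?N * (?m + 1) ^ 3"
    unfolding len by linarith
  show ?thesis
    using program_answers[OF body[OF n xs as E, folded ans]] le unfolding N by (meson le_trans)
qed

theorem theorem2:
  shows "\<exists>(P :: instr list) (C :: real) (D :: real) (p :: real poly poly).
    \<forall>(V :: nat set) (E :: nat set set) (k :: int) (xs :: int list).
      simple_graph V E \<longrightarrow> connected_graph V E \<longrightarrow> encodes_instance xs V E k \<longrightarrow>
      (\<exists>t. answers_in_time P xs (max_leaves_spanning_tree V E k) t \<and>
        real t \<le> C * real (card E)
          + D * (6.75 ^ nat k * poly (poly p [:real (card E):]) (real (nat k))))"
\<comment> \<open>The outer variable of the polynomial is evaluated at the constant polynomial
  \<open>[:real (card E):]\<close>, so \<open>[:1, 1:] ^ 3\<close> stands for the cube of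
  \<open>1 + real (card E)\<close>, constant in \<open>k\<close>.\<close>
proof (rule exI[of _ program], rule exI[of _ 0], rule exI[of _ 1100], rule exI[of _ "[:1, 1:] ^ 3"],
    intro allI impI)
  fix V :: "nat set" and E :: "nat set set" and k :: int and xs :: "int list"
  assume "simple_graph V E" "connected_graph V E" "encodes_instance xs V E k"
  then obtain t where t: "answers_in_time program xs (max_leaves_spanning_tree V E k) t"
    "t \<le> 1100 * 4 ^ nat k * (card E + 1) ^ 3" using program_correct by blast
  have "real t \<le> real (1100 * 4 ^ nat k * (card E + 1) ^ 3)" using t(2) by (rule of_nat_mono)
  also have "\<dots> = 1100 * (4 ^ nat k * (1 + real (card E)) ^ 3)" by (simp add: add.commute)
  also have "\<dots> \<le> 1100 * (6.75 ^ nat k * (1 + real (card E)) ^ 3)"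
    by (intro mult_left_mono mult_right_mono power_mono) auto
  also have "\<dots> = 0 * real (card E) +
      1100 * (6.75 ^ nat k * poly (poly ([:1, 1:] ^ 3) [:real (card E):]) (real (nat k)))"
    by (simp add: poly_power)
  finally show "\<exists>t. answers_in_time program xs (max_leaves_spanning_tree V E k) t \<and>
      real t \<le> 0 * real (card E) +
        1100 * (6.75 ^ nat k * poly (poly ([:1, 1:] ^ 3) [:real (card E):]) (real (nat k)))"
    using t(1) by blast
qed

end
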